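(* Let $d\ge2$ and $0<p<1$. There is a constant $C>0$ such that for all sufficiently large $n$, with $k=\lfloor C\log n\rfloor$, there is a $\mathbb{Q}\in\mathcal{A}(\mathbb{T}^d_n,k,p)$ such that $\mathbb{E}_{\mathbb{Q}}(f)\ge2$, where $f$ is the number of open paths from the root to the leaves of $\mathbb{T}^d_n$.
   Context: $\mathbb{T}^d_n$ is the rooted $d$-ary tree with $n$ levels. A (site) percolation on a graph $G=(V,E)$ is a probability distribution on $\{0,1\}^V$, the two values being identified with the states open and closed of the vertices; $\mathcal{A}(G,k,p)$ is the set of all $k$-wise independent percolations on $G$ (the states of any at most $k$ vertices are independent) in which every vertex is open with probability $p$. A path from the root to a leaf is open if all its vertices are open. *)

theory Defs
  imports "HOL-Probability.Probability" "Graph_Theory.Arc_Walk"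
begin

(* A vertex of the d-ary tree is the word of child indices (all below d) leading to it from the
   root []; the n levels consist of the words of lengths 0, ..., n - 1.  The undirected tree is
   represented by a symmetric digraph. *)
definition dary_tree_verts :: "nat \<Rightarrow> nat \<Rightarrow> nat list set" where
  "dary_tree_verts d n = {v. set v \<subseteq> {..<d} \<and> length v < n}"

definition dary_tree :: "nat \<Rightarrow> nat \<Rightarrow> (nat list, nat list \<times> nat list) pre_digraph" where
  "dary_tree d n =
     \<lparr> verts = dary_tree_verts d n,
       arcs = {(u, v). u \<in> dary_tree_verts d n \<and> v \<in> dary_tree_verts d n \<and>
                       (\<exists>i. v = u @ [i] \<or> u = v @ [i])},
       tail = fst, head = snd \<rparr>"

definition dary_tree_leaves :: "nat \<Rightarrow> nat \<Rightarrow> nat list set" where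
  "dary_tree_leaves d n = {v \<in> dary_tree_verts d n. Suc (length v) = n}"

(* Configurations are functions on the vertex set, True meaning open. *)
definition percolations :: "('v, 'e) pre_digraph \<Rightarrow> ('v \<Rightarrow> bool) measure set" where
  "percolations G =
     {Q. prob_space Q \<and> sets Q = sets (PiM (verts G) (\<lambda>_. count_space (UNIV :: bool set)))}"

definition kwise_indep_percolations ::
    "('v, 'e) pre_digraph \<Rightarrow> nat \<Rightarrow> real \<Rightarrow> ('v \<Rightarrow> bool) measure set" where
  "kwise_indep_percolations G k p =
     {Q \<in> percolations G.
        (\<forall>W \<subseteq> verts G. finite W \<and> card W \<le> k \<longrightarrow>
           prob_space.indep_vars Q (\<lambda>_. count_space UNIV) (\<lambda>v \<omega>. \<omega> v) W) \<and>
        (\<forall>v \<in> verts G. measure Q {\<omega> \<in> space Q. \<omega> v} = p)}"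

definition open_root_leaf_paths ::
    "nat \<Rightarrow> nat \<Rightarrow> (nat list \<Rightarrow> bool) \<Rightarrow> (nat list \<times> nat list) list set" where
  "open_root_leaf_paths d n \<omega> =
     {q. (\<exists>l \<in> dary_tree_leaves d n. pre_digraph.apath (dary_tree d n) [] q l) \<and>
         (\<forall>v \<in> set (pre_digraph.awalk_verts (dary_tree d n) [] q). \<omega> v)}"

end

theory Submission
  imports Defs "HOL-Library.Sublist" "HOL-Real_Asymp.Real_Asymp"
begin

text \<open>Plant the open cluster of the root of a slightly supercritical percolation with density
  \<open>\<rho> = 6 / (5 d)\<close> into independent percolation: the mean number of open paths becomes exponentially
  large, while two independent copies of the planted cluster have a subcritical intersection, so
  the Fourier coefficients of degree at most \<open>k\<close> of the planted law have an \<open>L\<^sup>2\<close> norm at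
  most exponential in \<open>k\<close>. Using the planted law with a small probability \<open>\<epsilon>\<close>, the rest of the mass
  can be chosen to cancel these coefficients unless some nonnegative polynomial of degree at most
  \<open>k\<close> has a much larger mean under the planted law than under the independent one. By
  hypercontractivity the \<open>L\<^sup>2\<close> norm of such a polynomial is at most exponential in \<open>k\<close> times its
  independent mean, so this does not happen for \<open>\<epsilon>\<close> exponentially small in \<open>k\<close>. With
  \<open>k \<le> log n\<close> the loss is polynomial in \<open>n\<close> and the gain is exponential.\<close>

subsection \<open>Fourier analysis on the biased cube\<close>

text \<open>Configurations are encoded as sets of open vertices, so that expectations under the
  product measure are finite sums over \<open>Pow V\<close>. Measure theory enters only in the final
  passage to \<open>percolations\<close>.\<close>

definition bern_weight :: "real \<Rightarrow> 'a set \<Rightarrow> 'a set \<Rightarrow> real" where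
  "bern_weight p V A = p ^ card A * (1 - p) ^ card (V - A)"

definition bern_exp :: "real \<Rightarrow> 'a set \<Rightarrow> ('a set \<Rightarrow> real) \<Rightarrow> real" where
  "bern_exp p V F = (\<Sum>A\<in>Pow V. bern_weight p V A * F A)"

text \<open>The Bernoulli variable centred and scaled to variance one, so that for 0 < p < 1 the
  products \<open>walsh p W\<close> are orthonormal under \<open>bern_exp\<close>.\<close>

definition bern_char :: "real \<Rightarrow> bool \<Rightarrow> real" where
  "bern_char p b = (if b then sqrt ((1 - p) / p) else - sqrt (p / (1 - p)))"

definition walsh :: "real \<Rightarrow> 'a set \<Rightarrow> 'a set \<Rightarrow> real" where
  "walsh p W A = (\<Prod>v\<in>W. bern_char p (v \<in> A))"

lemma bern_weight_nonneg: "0 \<le> p \<Longrightarrow> p \<le> 1 \<Longrightarrow> 0 \<le> bern_weight p V A"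
  by (simp add: bern_weight_def)

lemma bern_exp_mono:
  assumes "0 \<le> p" "p \<le> 1" "\<And>A. A \<subseteq> V \<Longrightarrow> F A \<le> G A"
  shows "bern_exp p V F \<le> bern_exp p V G"
  unfolding bern_exp_def
  by (intro sum_mono mult_left_mono) (use assms in \<open>auto simp: bern_weight_nonneg\<close>)

lemma bern_exp_cong: "(\<And>A. A \<subseteq> V \<Longrightarrow> F A = G A) \<Longrightarrow> bern_exp p V F = bern_exp p V G"
  unfolding bern_exp_def by (intro sum.cong) auto

lemma bern_exp_add: "bern_exp p V (\<lambda>A. F A + G A) = bern_exp p V F + bern_exp p V G"
  unfolding bern_exp_def by (simp add: algebra_simps sum.distrib)

lemma bern_exp_diff: "bern_exp p V (\<lambda>A. F A - G A) = bern_exp p V F - bern_exp p V G"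
  unfolding bern_exp_def by (simp add: algebra_simps sum_subtractf)

lemma bern_exp_cmult: "bern_exp p V (\<lambda>A. c * F A) = c * bern_exp p V F"
  unfolding bern_exp_def by (simp add: algebra_simps sum_distrib_left)

lemma bern_exp_sum: "bern_exp p V (\<lambda>A. \<Sum>i\<in>I. F i A) = (\<Sum>i\<in>I. bern_exp p V (F i))"
  unfolding bern_exp_def by (subst sum.swap) (simp add: sum_distrib_left)

text \<open>Expanding the product on the right chooses one summand at each vertex; the vertices
  where the first is chosen form the open set \<open>A\<close>.\<close>

lemma bern_exp_prod:
  assumes "finite V"
  shows "bern_exp p V (\<lambda>A. \<Prod>v\<in>V. h v (v \<in> A)) = (\<Prod>v\<in>V. p * h v True + (1 - p) * h v False)"
proof -
  have "bern_weight p V A * (\<Prod>v\<in>V. h v (v \<in> A)) =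
        (\<Prod>v\<in>A. p * h v True) * (\<Prod>v\<in>V - A. (1 - p) * h v False)" if "A \<in> Pow V" for A
  proof -
    have "(\<Prod>v\<in>V. h v (v \<in> A)) = (\<Prod>v\<in>A. h v (v \<in> A)) * (\<Prod>v\<in>V - A. h v (v \<in> A))"
      using prod.subset_diff[of A V "\<lambda>v. h v (v \<in> A)"] that assms by (simp add: mult.commute)
    also have "\<dots> = (\<Prod>v\<in>A. h v True) * (\<Prod>v\<in>V - A. h v False)"
      by (intro arg_cong2[of _ _ _ _ "(*)"] prod.cong) auto
    finally show ?thesis by (simp add: bern_weight_def prod.distrib)
  qed
  then show ?thesis
    unfolding bern_exp_def prod_add[OF assms] by (intro sum.cong refl)
qed

lemma bern_exp_prod_subset:
  assumes "finite V" "W \<subseteq> V"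
  shows "bern_exp p V (\<lambda>A. \<Prod>v\<in>W. h v (v \<in> A)) = (\<Prod>v\<in>W. p * h v True + (1 - p) * h v False)"
proof -
  let ?g = "\<lambda>v b. if v \<in> W then h v b else 1"
  have VW: "V \<inter> W = W" using assms(2) by blast
  have "(\<Prod>v\<in>W. h v (v \<in> A)) = (\<Prod>v\<in>V. ?g v (v \<in> A))" for A
    using prod.inter_restrict[OF assms(1), of "\<lambda>v. h v (v \<in> A)" W] VW by simp
  moreover have "(\<Prod>v\<in>W. p * h v True + (1 - p) * h v False) =
      (\<Prod>v\<in>V. p * ?g v True + (1 - p) * ?g v False)"
    using prod.inter_restrict[OF assms(1), of "\<lambda>v. p * h v True + (1 - p) * h v False" W] VW
    by (simp add: if_distrib cong: if_cong)
  ultimately show ?thesis using bern_exp_prod[OF assms(1), of p ?g] by simp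
qed

lemma bern_exp_one: "finite V \<Longrightarrow> bern_exp p V (\<lambda>_. 1) = 1"
  using bern_exp_prod_subset[of V "{}" p "\<lambda>_ _. 1"] by simp

lemma sum_Pow_insert:
  assumes "finite V" "v \<notin> V"
  shows "(\<Sum>A\<in>Pow (insert v V). F A) = (\<Sum>A\<in>Pow V. F A) + (\<Sum>A\<in>Pow V. F (insert v A))"
proof -
  have "inj_on (insert v) (Pow V)"
    using assms(2) by (auto simp: inj_on_def)
  moreover have "Pow V \<inter> insert v ` Pow V = {}"
    using assms(2) by auto
  ultimately show ?thesis
    using assms(1) by (simp add: Pow_insert sum.union_disjoint sum.reindex)
qed

text \<open>Conditioning on the state of \<open>v\<close>. This is the coordinate step in the
  inductions of \<open>walsh_parseval\<close> and \<open>bonami\<close>.\<close>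

lemma bern_exp_insert:
  assumes "finite V" "v \<notin> V"
  shows "bern_exp p (insert v V) F =
         bern_exp p V (\<lambda>A. p * F (insert v A) + (1 - p) * F A)"
proof -
  have "bern_weight p (insert v V) A = (1 - p) * bern_weight p V A" if "A \<in> Pow V" for A
  proof -
    have "insert v V - A = insert v (V - A)" using that assms by auto
    then show ?thesis using assms by (simp add: bern_weight_def)
  qed
  moreover have "bern_weight p (insert v V) (insert v A) = p * bern_weight p V A" if "A \<in> Pow V" for A
  proof -
    have "insert v V - insert v A = V - A" "v \<notin> A" "finite A" using that assms
      by (auto intro: finite_subset)
    then show ?thesis by (simp add: bern_weight_def)
  qed
  ultimately have "bern_exp p (insert v V) F =
      (\<Sum>A\<in>Pow V. (1 - p) * bern_weight p V A * F A)
      + (\<Sum>A\<in>Pow V. p * bern_weight p V A * F (insert v A))"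
    unfolding bern_exp_def sum_Pow_insert[OF assms]
    by (intro arg_cong2[of _ _ _ _ "(+)"] sum.cong refl) auto
  then show ?thesis
    unfolding bern_exp_def sum.distrib[symmetric] by (simp add: algebra_simps)
qed

lemma bern_char_moments:
  assumes "0 < p" "p < 1"
  shows "p * bern_char p True + (1 - p) * bern_char p False = 0"
    and "p * (bern_char p True)\<^sup>2 + (1 - p) * (bern_char p False)\<^sup>2 = 1"
proof -
  have root: "a * sqrt (b / a) = sqrt (a * b)" if "0 < a" for a b :: real
  proof -
    have "a * sqrt (b / a) = sqrt (a\<^sup>2 * (b / a))" using that by (simp add: real_sqrt_mult[of "a\<^sup>2"] del: times_divide_eq_right)
    also have "a\<^sup>2 * (b / a) = a * b" using that by (simp add: power2_eq_square)
    finally show ?thesis .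
  qed
  have "p * sqrt ((1 - p) / p) = sqrt (p * (1 - p))" "(1 - p) * sqrt (p / (1 - p)) = sqrt (p * (1 - p))"
    using assms root[of p "1 - p"] root[of "1 - p" p] by (auto simp: mult.commute)
  then show "p * bern_char p True + (1 - p) * bern_char p False = 0"
    by (simp add: bern_char_def)
  show "p * (bern_char p True)\<^sup>2 + (1 - p) * (bern_char p False)\<^sup>2 = 1"
    using assms by (simp add: bern_char_def)
qed

lemma walsh_empty [simp]: "walsh p {} A = 1"
  by (simp add: walsh_def)

lemma bern_exp_walsh:
  assumes "0 < p" "p < 1" "finite V" "W \<subseteq> V"
  shows "bern_exp p V (walsh p W) = (if W = {} then 1 else 0)"
proof -
  have "finite W" using assms finite_subset by blast
  then show ?thesis
    using bern_exp_prod_subset[OF assms(3,4), of p "\<lambda>_. bern_char p"] bern_char_moments[OF assms(1,2)]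
    by (auto simp: walsh_def[abs_def] card_gt_0_iff)
qed

text \<open>Splitting off \<open>v\<close> writes a polynomial as a + \<chi> b, where \<chi> is the
  character of \<open>v\<close> and a, b do not depend on \<open>v\<close>. The two equations are
  the two states of \<open>v\<close>.\<close>

lemma walsh_sum_insert:
  assumes "finite V" "v \<notin> V" "A \<subseteq> V"
  shows "(\<Sum>W\<in>Pow (insert v V). c W * walsh p W A) =
          (\<Sum>W\<in>Pow V. c W * walsh p W A)
          + bern_char p False * (\<Sum>W\<in>Pow V. c (insert v W) * walsh p W A)"
    and "(\<Sum>W\<in>Pow (insert v V). c W * walsh p W (insert v A)) =
          (\<Sum>W\<in>Pow V. c W * walsh p W A)
          + bern_char p True * (\<Sum>W\<in>Pow V. c (insert v W) * walsh p W A)"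
proof -
  have *: "walsh p (insert v W) B = bern_char p (v \<in> B) * walsh p W B"
      "walsh p W (insert v B) = walsh p W B" if "W \<subseteq> V" for W B
  proof -
    have "v \<notin> W" "finite W" using that assms by (auto intro: finite_subset)
    then show "walsh p (insert v W) B = bern_char p (v \<in> B) * walsh p W B"
      by (simp add: walsh_def)
    show "walsh p W (insert v B) = walsh p W B"
      unfolding walsh_def using \<open>v \<notin> W\<close> by (intro prod.cong refl arg_cong[of _ _ "bern_char p"]) auto
  qed
  have "v \<notin> A" using assms by auto
  then show "(\<Sum>W\<in>Pow (insert v V). c W * walsh p W A) =
          (\<Sum>W\<in>Pow V. c W * walsh p W A)
          + bern_char p False * (\<Sum>W\<in>Pow V. c (insert v W) * walsh p W A)"
    unfolding sum_Pow_insert[OF assms(1,2)] sum_distrib_left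
    by (intro arg_cong2[of _ _ _ _ "(+)"] sum.cong refl) (auto simp: *)
  show "(\<Sum>W\<in>Pow (insert v V). c W * walsh p W (insert v A)) =
          (\<Sum>W\<in>Pow V. c W * walsh p W A)
          + bern_char p True * (\<Sum>W\<in>Pow V. c (insert v W) * walsh p W A)"
    unfolding sum_Pow_insert[OF assms(1,2)] sum_distrib_left
    by (intro arg_cong2[of _ _ _ _ "(+)"] sum.cong refl) (auto simp: *)
qed

text \<open>In the splitting a + \<chi> b at one vertex, the mean zero of \<chi> kills the cross
  term and its variance one leaves a^2 + b^2.\<close>

lemma walsh_parseval:
  assumes "0 < p" "p < 1" "finite V"
  shows "bern_exp p V (\<lambda>A. (\<Sum>W\<in>Pow V. c W * walsh p W A)\<^sup>2) = (\<Sum>W\<in>Pow V. (c W)\<^sup>2)"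
  using assms(3)
proof (induction V arbitrary: c rule: finite_induct)
  case empty
  show ?case by (simp add: bern_exp_def bern_weight_def)
next
  case (insert v V)
  let ?a = "\<lambda>A. \<Sum>W\<in>Pow V. c W * walsh p W A" and ?b = "\<lambda>A. \<Sum>W\<in>Pow V. c (insert v W) * walsh p W A"
  let ?x = "bern_char p True" and ?y = "bern_char p False"
  note m = bern_char_moments[OF assms(1,2)]
  have pt: "p * (a + ?x * b)\<^sup>2 + (1 - p) * (a + ?y * b)\<^sup>2 = a\<^sup>2 + b\<^sup>2" for a b
  proof -
    have "p * (a + ?x * b)\<^sup>2 + (1 - p) * (a + ?y * b)\<^sup>2 =
      a\<^sup>2 + 2 * a * b * (p * ?x + (1 - p) * ?y) + b\<^sup>2 * (p * ?x\<^sup>2 + (1 - p) * ?y\<^sup>2)"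
      by (simp add: power2_eq_square algebra_simps)
    then show ?thesis using m by simp
  qed
  have "bern_exp p (insert v V) (\<lambda>A. (\<Sum>W\<in>Pow (insert v V). c W * walsh p W A)\<^sup>2) =
        bern_exp p V (\<lambda>A. (?a A)\<^sup>2 + (?b A)\<^sup>2)"
    unfolding bern_exp_insert[OF insert.hyps]
    by (intro bern_exp_cong) (simp only: walsh_sum_insert[OF insert.hyps] pt)
  also have "\<dots> = (\<Sum>W\<in>Pow (insert v V). (c W)\<^sup>2)"
    using insert.IH[of c] insert.IH[of "\<lambda>W. c (insert v W)"]
    by (simp add: bern_exp_add sum_Pow_insert[OF insert.hyps])
  finally show ?case .
qed

section \<open>Hypercontractivity and norms of nonnegative low-degree polynomials\<close>

lemma bern_exp_cauchy_schwarz: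
  assumes "0 \<le> p" "p \<le> 1"
  shows "(bern_exp p V (\<lambda>A. F A * G A))\<^sup>2 \<le> bern_exp p V (\<lambda>A. (F A)\<^sup>2) * bern_exp p V (\<lambda>A. (G A)\<^sup>2)"
proof -
  have "sqrt (bern_weight p V A) * sqrt (bern_weight p V A) = bern_weight p V A" for A
    using bern_weight_nonneg[OF assms, of V A] by simp
  then show ?thesis
    using Cauchy_Schwarz_ineq_sum[of "\<lambda>A. sqrt (bern_weight p V A) * F A"
        "\<lambda>A. sqrt (bern_weight p V A) * G A" "Pow V"] bern_weight_nonneg[OF assms, of V]
    unfolding bern_exp_def by (simp add: power_mult_distrib mult.commute mult.left_commute mult.assoc)
qed

text \<open>The induction step of \<open>bonami\<close> needs a number s with 8 \<le> 2 s and m4 + 2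
  m3^2 \<le> s^2, where m3 and m4 are the third and fourth moments of \<open>bern_char p\<close>.
  The 4 gives the first condition and the other summands the second.\<close>

definition hyp_const :: "real \<Rightarrow> real" where
  "hyp_const p = 4 + (p * bern_char p True ^ 4 + (1 - p) * bern_char p False ^ 4)
     + 2 * (p * bern_char p True ^ 3 + (1 - p) * bern_char p False ^ 3)\<^sup>2"

lemma hyp_const_ge: "0 < p \<Longrightarrow> p < 1 \<Longrightarrow> 4 \<le> hyp_const p"
  by (simp add: hyp_const_def)

text \<open>Bonami's inequality. Weighting coefficients by \<open>hyp_const p\<close> to the power of their degree makes the
  induction on the coordinates close.\<close>

lemma bonami:
  assumes "0 < p" "p < 1" "finite V"
  shows "bern_exp p V (\<lambda>A. (\<Sum>W\<in>Pow V. c W * walsh p W A) ^ 4)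
         \<le> (\<Sum>W\<in>Pow V. hyp_const p ^ card W * (c W)\<^sup>2)\<^sup>2"
  using assms(3)
proof (induction V arbitrary: c rule: finite_induct)
  case empty
  show ?case by (simp add: bern_exp_def bern_weight_def)
next
  case (insert v V)
  let ?s = "hyp_const p"
  let ?a = "\<lambda>A. \<Sum>W\<in>Pow V. c W * walsh p W A" and ?b = "\<lambda>A. \<Sum>W\<in>Pow V. c (insert v W) * walsh p W A"
  let ?x = "bern_char p True" and ?y = "bern_char p False"
  define m3 where "m3 = p * ?x ^ 3 + (1 - p) * ?y ^ 3"
  define m4 where "m4 = p * ?x ^ 4 + (1 - p) * ?y ^ 4"
  define \<alpha> where "\<alpha> = (\<Sum>W\<in>Pow V. ?s ^ card W * (c W)\<^sup>2)"
  define \<beta> where "\<beta> = (\<Sum>W\<in>Pow V. ?s ^ card W * (c (insert v W))\<^sup>2)"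
  note m = bern_char_moments[OF assms(1,2)]
  have s: "4 \<le> ?s" using hyp_const_ge[OF assms(1,2)] .
  have nn: "0 \<le> \<alpha>" "0 \<le> \<beta>" unfolding \<alpha>_def \<beta>_def using s by (auto intro!: sum_nonneg)
  have a4: "bern_exp p V (\<lambda>A. ?a A ^ 4) \<le> \<alpha>\<^sup>2" unfolding \<alpha>_def by (rule insert.IH)
  have b4: "bern_exp p V (\<lambda>A. ?b A ^ 4) \<le> \<beta>\<^sup>2" unfolding \<beta>_def by (rule insert.IH)
  \<comment> \<open>The linear term vanishes by centring. The third-moment term 4 m3 a b^3 is
    absorbed by completing a square, which raises the coefficient 6 of a^2 b^2 to 8 and costs 2 m3^2
    b^4.\<close>
  have pt: "p * (a + ?x * b) ^ 4 + (1 - p) * (a + ?y * b) ^ 4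
            \<le> a ^ 4 + 8 * (a\<^sup>2 * b\<^sup>2) + (m4 + 2 * m3\<^sup>2) * b ^ 4" for a b
  proof -
    have "p * (a + ?x * b) ^ 4 + (1 - p) * (a + ?y * b) ^ 4 =
      a ^ 4 + 4 * a ^ 3 * b * (p * ?x + (1 - p) * ?y) + 6 * a\<^sup>2 * b\<^sup>2 * (p * ?x\<^sup>2 + (1 - p) * ?y\<^sup>2)
      + 4 * a * b ^ 3 * m3 + b ^ 4 * m4"
      unfolding m3_def m4_def
      by (simp add: power2_eq_square power3_eq_cube power4_eq_xxxx algebra_simps)
    also have "\<dots> = a ^ 4 + 8 * (a\<^sup>2 * b\<^sup>2) + (m4 + 2 * m3\<^sup>2) * b ^ 4 - 2 * (b * (a - m3 * b))\<^sup>2"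
      unfolding m by (simp add: power2_eq_square power3_eq_cube power4_eq_xxxx algebra_simps)
    finally show ?thesis by simp
  qed
  \<comment> \<open>Cauchy-Schwarz reduces the mixed term to the two fourth moments covered by the
    induction hypothesis.\<close>
  have "(bern_exp p V (\<lambda>A. (?a A)\<^sup>2 * (?b A)\<^sup>2))\<^sup>2
        \<le> bern_exp p V (\<lambda>A. ((?a A)\<^sup>2)\<^sup>2) * bern_exp p V (\<lambda>A. ((?b A)\<^sup>2)\<^sup>2)"
    using assms(1,2) by (intro bern_exp_cauchy_schwarz) auto
  also have "\<dots> = bern_exp p V (\<lambda>A. ?a A ^ 4) * bern_exp p V (\<lambda>A. ?b A ^ 4)"
    by (simp flip: power_mult)
  also have "\<dots> \<le> \<alpha>\<^sup>2 * \<beta>\<^sup>2"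
    by (intro mult_mono a4 b4 zero_le_power2)
      (use assms bern_exp_mono[of p V "\<lambda>_. 0" "\<lambda>A. ?b A ^ 4"] in \<open>auto simp: bern_exp_def\<close>)
  finally have ab: "bern_exp p V (\<lambda>A. (?a A)\<^sup>2 * (?b A)\<^sup>2) \<le> \<alpha> * \<beta>"
    using nn by (intro power2_le_imp_le[OF _ mult_nonneg_nonneg]) (auto simp: power_mult_distrib)
  have "bern_exp p (insert v V) (\<lambda>A. (\<Sum>W\<in>Pow (insert v V). c W * walsh p W A) ^ 4)
        \<le> bern_exp p V (\<lambda>A. ?a A ^ 4 + 8 * ((?a A)\<^sup>2 * (?b A)\<^sup>2) + (m4 + 2 * m3\<^sup>2) * ?b A ^ 4)"
    unfolding bern_exp_insert[OF insert.hyps]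
    using assms(1,2) by (intro bern_exp_mono) (auto simp only: walsh_sum_insert[OF insert.hyps] intro: pt)
  also have "\<dots> = bern_exp p V (\<lambda>A. ?a A ^ 4) + 8 * bern_exp p V (\<lambda>A. (?a A)\<^sup>2 * (?b A)\<^sup>2)
                + (m4 + 2 * m3\<^sup>2) * bern_exp p V (\<lambda>A. ?b A ^ 4)"
    by (simp only: bern_exp_add bern_exp_cmult)
  also have "\<dots> \<le> \<alpha>\<^sup>2 + 8 * (\<alpha> * \<beta>) + (m4 + 2 * m3\<^sup>2) * \<beta>\<^sup>2"
    using assms(1,2) by (intro add_mono mult_left_mono a4 b4 ab) (auto simp: m4_def)
  \<comment> \<open>The defining properties of \<open>hyp_const p\<close> turn the bound into the
    perfect square of \<alpha> + s \<beta>. The factor s on \<beta> accounts for the extra degree of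
    the sets containing \<open>v\<close>.\<close>
  also have "\<dots> \<le> \<alpha>\<^sup>2 + 2 * ?s * (\<alpha> * \<beta>) + ?s\<^sup>2 * \<beta>\<^sup>2"
  proof (intro add_mono mult_right_mono order_refl)
    have "m4 + 2 * m3\<^sup>2 \<le> ?s" by (simp add: hyp_const_def m3_def m4_def)
    also have "?s * 1 \<le> ?s * ?s" using s by (intro mult_left_mono) auto
    finally show "m4 + 2 * m3\<^sup>2 \<le> ?s\<^sup>2" by (simp add: power2_eq_square)
  qed (use nn s in auto)
  also have "\<dots> = (\<alpha> + ?s * \<beta>)\<^sup>2"
    by (simp add: power2_eq_square algebra_simps)
  also have "\<alpha> + ?s * \<beta> = (\<Sum>W\<in>Pow (insert v V). ?s ^ card W * (c W)\<^sup>2)"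
  proof -
    have "card (insert v W) = Suc (card W)" if "W \<in> Pow V" for W
      using that insert.hyps finite_subset by (subst card_insert_disjoint) auto
    then show ?thesis
      unfolding sum_Pow_insert[OF insert.hyps] \<alpha>_def \<beta>_def sum_distrib_left
      by (intro arg_cong2[of _ _ _ _ "(+)"] sum.cong refl) (simp only: power_Suc mult.assoc)
  qed
  finally show ?case .
qed

text \<open>For \<open>u \<ge> 0\<close> we have \<open>u \<ge> 3/2 u\<^sup>2 - 1/2 u\<^sup>4\<close>; at the right scale this bounds
  the first moment of \<open>q\<close> from below by its second and fourth moments.\<close>

lemma nonneg_low_degree_norm_le:
  assumes "0 < p" "p < 1" "finite V"
    and nonneg: "\<And>A. A \<subseteq> V \<Longrightarrow> 0 \<le> (\<Sum>W\<in>Pow V. c W * walsh p W A)"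
    and deg: "\<And>W. W \<subseteq> V \<Longrightarrow> k < card W \<Longrightarrow> c W = 0"
  shows "sqrt (\<Sum>W\<in>Pow V. (c W)\<^sup>2) \<le> hyp_const p ^ k * c {}"
proof -
  let ?s = "hyp_const p" and ?q = "\<lambda>A. \<Sum>W\<in>Pow V. c W * walsh p W A"
  define T where "T = (\<Sum>W\<in>Pow V. (c W)\<^sup>2)"
  have s: "4 \<le> ?s" using hyp_const_ge[OF assms(1,2)] .
  have Eq: "bern_exp p V ?q = c {}"
  proof -
    have "bern_exp p V ?q = (\<Sum>W\<in>Pow V. c W * (if W = {} then 1 else 0))"
      using assms by (simp add: bern_exp_sum bern_exp_cmult bern_exp_walsh)
    also have "\<dots> = (\<Sum>W\<in>Pow V. if W = {} then c W else 0)" by (intro sum.cong) auto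
    also have "\<dots> = c {}" using assms(3) by simp
    finally show ?thesis .
  qed
  have q0: "0 \<le> c {}"
    using bern_exp_mono[of p V "\<lambda>_. 0" ?q] nonneg assms(1,2) Eq by (simp add: bern_exp_def)
  show ?thesis
  proof (cases "T = 0")
    case True
    then show ?thesis using q0 s unfolding T_def by simp
  next
    case False
    then have T: "0 < T" unfolding T_def by (metis less_le sum_nonneg zero_le_power2)
    \<comment> \<open>At this scale Bonami's bound on the fourth moment reads t^2 T, so the lower
      bound for the mean becomes (3/2 - 1/2) T / t = T / t.\<close>
    define t where "t = ?s ^ k * sqrt T"
    have t: "0 < t" using T s unfolding t_def by simp
    have "(\<Sum>W\<in>Pow V. ?s ^ card W * (c W)\<^sup>2) \<le> (\<Sum>W\<in>Pow V. ?s ^ k * (c W)\<^sup>2)"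
    proof (intro sum_mono)
      fix W assume "W \<in> Pow V"
      then show "?s ^ card W * (c W)\<^sup>2 \<le> ?s ^ k * (c W)\<^sup>2"
        using deg[of W] s by (cases "k < card W") (auto intro!: mult_right_mono power_increasing)
    qed
    also have "\<dots> = ?s ^ k * T" by (simp add: T_def sum_distrib_left)
    finally have "(\<Sum>W\<in>Pow V. ?s ^ card W * (c W)\<^sup>2)\<^sup>2 \<le> (?s ^ k * T)\<^sup>2"
      using s by (intro power_mono sum_nonneg) auto
    also have "(?s ^ k * T)\<^sup>2 = t\<^sup>2 * T"
      using T by (simp add: t_def power_mult_distrib power2_eq_square)
    finally have q4: "bern_exp p V (\<lambda>A. ?q A ^ 4) \<le> t\<^sup>2 * T"
      using bonami[OF assms(1-3), of c] by linarith
    have q2: "bern_exp p V (\<lambda>A. (?q A)\<^sup>2) = T"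
      unfolding T_def by (rule walsh_parseval[OF assms(1-3)])
    \<comment> \<open>After division by x, the difference of the two sides is a cubic with a double
      root at t and a simple root at -2 t, hence nonnegative for x \<ge> 0.\<close>
    have pt: "3 / (2 * t) * x\<^sup>2 - 1 / (2 * t ^ 3) * x ^ 4 \<le> x" if "0 \<le> x" for x
    proof -
      have "0 \<le> x / (2 * t ^ 3) * ((x - t)\<^sup>2 * (x + 2 * t))" using that t by simp
      also have "\<dots> = x - (3 / (2 * t) * x\<^sup>2 - 1 / (2 * t ^ 3) * x ^ 4)"
        using t by (simp add: field_simps power2_eq_square power3_eq_cube power4_eq_xxxx)
      finally show ?thesis by simp
    qed
    have "T / t = 3 / (2 * t) * T - 1 / (2 * t ^ 3) * (t\<^sup>2 * T)"
      using t by (simp add: field_simps power2_eq_square power3_eq_cube)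
    also have "\<dots> \<le> 3 / (2 * t) * T - 1 / (2 * t ^ 3) * bern_exp p V (\<lambda>A. ?q A ^ 4)"
      using q4 t by (intro diff_left_mono mult_left_mono) auto
    also have "\<dots> = bern_exp p V (\<lambda>A. 3 / (2 * t) * (?q A)\<^sup>2 - 1 / (2 * t ^ 3) * ?q A ^ 4)"
      unfolding bern_exp_diff bern_exp_cmult q2 ..
    also have "\<dots> \<le> bern_exp p V ?q"
      using assms(1,2) by (intro bern_exp_mono pt nonneg) auto
    finally have "T / t \<le> c {}" using Eq by simp
    moreover have "T / t = sqrt T / ?s ^ k"
      unfolding t_def using T s real_div_sqrt[of T] by (simp add: mult.commute flip: divide_divide_eq_left)
    ultimately have "sqrt T / ?s ^ k \<le> c {}" by simp
    then show ?thesis using s by (simp add: T_def field_simps)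
  qed
qed

subsection \<open>Cancelling low-degree moments\<close>

text \<open>Probability vectors on \<open>\<Omega>\<close> are extended by zero to the whole type,
  so that they lie in a cube that is compact by Tychonoff; the remaining conditions are closed.
  Compactness supplies the minimiser in \<open>moment_correction\<close>.\<close>

lemma compact_simplex:
  fixes \<Omega> :: "'a set"
  assumes "finite \<Omega>"
  shows "compact {h :: 'a \<Rightarrow> real. (\<forall>x. 0 \<le> h x) \<and> (\<forall>x. x \<notin> \<Omega> \<longrightarrow> h x = 0) \<and> sum h \<Omega> = 1}"
    (is "compact ?H")
proof -
  define B where "B = (PiE UNIV (\<lambda>_. {0..1}) :: ('a \<Rightarrow> real) set)"
  have "compactin (product_topology (\<lambda>_. euclidean) UNIV) B"
    unfolding B_def by (subst compactin_PiE) (simp add: compactin_euclidean_iff)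
  then have "compact B"
    by (simp add: euclidean_product_topology compactin_euclidean_iff)
  have coord: "continuous_on UNIV (\<lambda>h :: 'a \<Rightarrow> real. h x)" for x
    by (rule continuous_on_product_coordinates)
  have "closed ({h :: 'a \<Rightarrow> real. \<forall>x. 0 \<le> h x} \<inter> {h. \<forall>x. x \<notin> \<Omega> \<longrightarrow> h x = 0} \<inter> {h. sum h \<Omega> = 1})"
    by (intro closed_Int closed_Collect_all closed_Collect_imp closed_Collect_le closed_Collect_eq
        continuous_intros coord open_Collect_const)
  moreover have "?H = B \<inter> ({h. \<forall>x. 0 \<le> h x} \<inter> {h. \<forall>x. x \<notin> \<Omega> \<longrightarrow> h x = 0} \<inter> {h. sum h \<Omega> = 1})"
  proof -
    have "h x \<le> 1" if "\<forall>x. 0 \<le> h x" "\<forall>x. x \<notin> \<Omega> \<longrightarrow> h x = 0" "sum h \<Omega> = 1" for h :: "'a \<Rightarrow> real" and x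
      using that assms member_le_sum[of x \<Omega> h] by (cases "x \<in> \<Omega>") auto
    then show ?thesis by (auto simp: B_def)
  qed
  ultimately show ?thesis using compact_Int_closed[OF \<open>compact B\<close>] by simp
qed

text \<open>The correction \<open>h\<close> minimises the sum of the squared moments of \<open>\<epsilon> g + (1 - \<epsilon>) h\<close>.
  Where this sum has its minimum, the first-order condition says that the combination of
  the \<open>\<phi> i\<close> with the moments as coefficients is smallest on the support of \<open>h\<close>, so the
  hypothesis applies to it.\<close>

lemma moment_correction:
  fixes g :: "'a \<Rightarrow> real" and \<phi> :: "'i \<Rightarrow> 'a \<Rightarrow> real"
  assumes "finite \<Omega>" "finite I" "0 \<le> \<epsilon>" "\<epsilon> < 1"
    and g: "\<And>x. x \<in> \<Omega> \<Longrightarrow> 0 \<le> g x" "sum g \<Omega> = 1"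
    and dual: "\<And>c \<beta>. (\<And>x. x \<in> \<Omega> \<Longrightarrow> \<beta> \<le> (\<Sum>i\<in>I. c i * \<phi> i x)) \<Longrightarrow>
       \<epsilon> * ((\<Sum>x\<in>\<Omega>. g x * (\<Sum>i\<in>I. c i * \<phi> i x)) - \<beta>) \<le> - \<beta>"
  obtains w where "\<And>x. x \<in> \<Omega> \<Longrightarrow> \<epsilon> * g x \<le> w x" "sum w \<Omega> = 1"
    and "\<And>i. i \<in> I \<Longrightarrow> (\<Sum>x\<in>\<Omega>. w x * \<phi> i x) = 0"
proof -
  define H where "H = {h :: 'a \<Rightarrow> real. (\<forall>x. 0 \<le> h x) \<and> (\<forall>x. x \<notin> \<Omega> \<longrightarrow> h x = 0) \<and> sum h \<Omega> = 1}"
  define mom where "mom h i = (\<Sum>x\<in>\<Omega>. (\<epsilon> * g x + (1 - \<epsilon>) * h x) * \<phi> i x)" for h i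
  define \<Phi> where "\<Phi> h = (\<Sum>i\<in>I. (mom h i)\<^sup>2)" for h
  have "compact H" unfolding H_def by (rule compact_simplex[OF assms(1)])
  moreover have "\<Omega> \<noteq> {}" using g(2) by auto
  then obtain x0 where "x0 \<in> \<Omega>" by blast
  then have "(\<lambda>x. if x = x0 then 1 else 0) \<in> H" using assms(1) by (auto simp: H_def)
  then have "H \<noteq> {}" by blast
  moreover have "continuous_on H \<Phi>"
    unfolding \<Phi>_def mom_def
    by (intro continuous_intros continuous_on_subset[OF continuous_on_product_coordinates]) auto
  ultimately obtain h where h: "h \<in> H" and min: "\<And>h'. h' \<in> H \<Longrightarrow> \<Phi> h \<le> \<Phi> h'"
    using continuous_attains_inf by metis
  have h0: "0 \<le> h x" and h1: "sum h \<Omega> = 1" for x using h by (auto simp: H_def)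
  define q where "q x = (\<Sum>i\<in>I. mom h i * \<phi> i x)" for x
  define \<beta> where "\<beta> = (\<Sum>x\<in>\<Omega>. h x * q x)"
  have opt: "\<beta> \<le> q y" if y: "y \<in> \<Omega>" for y
  proof -
    \<comment> \<open>The rate of change of the i-th moment when \<open>h\<close> moves towards the
      point mass at \<open>y\<close>. The objective then changes by the quadratic 2 t D + t^2
      E.\<close>
    define e where "e i = (1 - \<epsilon>) * (\<phi> i y - (\<Sum>x\<in>\<Omega>. h x * \<phi> i x))" for i
    define D where "D = (\<Sum>i\<in>I. mom h i * e i)"
    define E where "E = (\<Sum>i\<in>I. (e i)\<^sup>2)"
    have step: "0 \<le> 2 * t * D + t\<^sup>2 * E" if t: "0 < t" "t \<le> 1" for t
    proof -
      define h' where "h' x = (1 - t) * h x + t * (if x = y then 1 else 0)" for x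
      have "h' \<in> H"
        using t h y assms(1) by (auto simp: H_def h'_def sum.distrib simp flip: sum_distrib_left)
      have "mom h' i = mom h i + t * e i" for i
      proof -
        have "mom h' i = (\<Sum>x\<in>\<Omega>. (\<epsilon> * g x + (1 - \<epsilon>) * h x) * \<phi> i x
            + (1 - \<epsilon>) * t * (if x = y then \<phi> i x else 0) - (1 - \<epsilon>) * t * (h x * \<phi> i x))"
          unfolding mom_def h'_def by (intro sum.cong) (auto simp: algebra_simps)
        also have "\<dots> = mom h i + t * e i"
          using y assms(1)
          by (simp add: mom_def e_def sum.distrib sum_subtractf algebra_simps flip: sum_distrib_left)
        finally show ?thesis .
      qed
      then have "\<Phi> h' = (\<Sum>i\<in>I. (mom h i)\<^sup>2 + 2 * t * (mom h i * e i) + t\<^sup>2 * (e i)\<^sup>2)"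
        unfolding \<Phi>_def by (intro sum.cong) (auto simp: power2_eq_square algebra_simps)
      also have "\<dots> = \<Phi> h + 2 * t * D + t\<^sup>2 * E"
        by (simp add: \<Phi>_def D_def E_def sum.distrib sum_distrib_left)
      finally show ?thesis using min[OF \<open>h' \<in> H\<close>] by simp
    qed
    have "0 \<le> D"
    proof (rule ccontr)
      assume "\<not> 0 \<le> D"
      have E0: "0 \<le> E" unfolding E_def by (intro sum_nonneg) auto
      \<comment> \<open>If D were negative, this step would decrease the objective: t E \<le> -D
        makes 2 D + t E negative. The cap 1 keeps \<open>h'\<close> in the simplex, and E + 1 avoids
        division by zero.\<close>
      define t where "t = min 1 (- D / (E + 1))"
      have t: "0 < t" "t \<le> 1" using \<open>\<not> 0 \<le> D\<close> E0 unfolding t_def by (auto simp: divide_neg_pos)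
      have "t * E \<le> (- D / (E + 1)) * E" using E0 unfolding t_def by (intro mult_right_mono) auto
      also have "\<dots> \<le> - D" using \<open>\<not> 0 \<le> D\<close> E0 by (simp add: field_simps)
      finally have "2 * D + t * E < 0" using \<open>\<not> 0 \<le> D\<close> by simp
      then have "t * (2 * D + t * E) < 0" using t by (simp add: mult_pos_neg)
      then show False using step[OF t] by (simp add: algebra_simps power2_eq_square)
    qed
    moreover have "D = (1 - \<epsilon>) * (q y - \<beta>)"
    proof -
      have "\<beta> = (\<Sum>i\<in>I. mom h i * (\<Sum>x\<in>\<Omega>. h x * \<phi> i x))"
        unfolding \<beta>_def q_def sum_distrib_left
        by (subst sum.swap) (simp add: algebra_simps)
      then show ?thesis
        by (simp add: D_def e_def q_def algebra_simps sum_subtractf sum.distrib sum_distrib_left)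
    qed
    ultimately show ?thesis using assms(4) by (simp add: zero_le_mult_iff)
  qed
  \<comment> \<open>The sum of squared moments is itself the integral of \<open>q\<close> against
    the mixture. Since \<beta> is a lower bound for \<open>q\<close> on \<open>\<Omega>\<close>, the
    hypothesis \<open>dual\<close> makes this integral nonpositive, so all moments vanish.\<close>
  have "\<Phi> h = (\<Sum>x\<in>\<Omega>. (\<epsilon> * g x + (1 - \<epsilon>) * h x) * q x)"
    unfolding \<Phi>_def q_def sum_distrib_left
    by (subst sum.swap) (simp add: mom_def power2_eq_square sum_distrib_left algebra_simps)
  also have "\<dots> = \<epsilon> * (\<Sum>x\<in>\<Omega>. g x * q x) + (1 - \<epsilon>) * \<beta>"
    unfolding \<beta>_def sum_distrib_left sum.distrib[symmetric] by (intro sum.cong) (auto simp: algebra_simps)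
  also have "\<dots> = \<epsilon> * ((\<Sum>x\<in>\<Omega>. g x * q x) - \<beta>) + \<beta>"
    by (simp add: algebra_simps)
  also have "\<dots> \<le> 0"
    using dual[of \<beta> "mom h"] opt unfolding q_def by fastforce
  finally have "\<Phi> h \<le> 0" .
  then have "\<Phi> h = 0" unfolding \<Phi>_def by (intro antisym sum_nonneg) auto
  then have zero: "mom h i = 0" if "i \<in> I" for i
    using that assms(2) unfolding \<Phi>_def by (simp add: sum_nonneg_eq_0_iff)
  show ?thesis
  proof (rule that[of "\<lambda>x. \<epsilon> * g x + (1 - \<epsilon>) * h x"])
    show "\<epsilon> * g x \<le> \<epsilon> * g x + (1 - \<epsilon>) * h x" for x using h0 assms(4) by simp
    show "(\<Sum>x\<in>\<Omega>. \<epsilon> * g x + (1 - \<epsilon>) * h x) = 1"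
      using g(2) h1 by (simp add: sum.distrib flip: sum_distrib_left)
    show "(\<Sum>x\<in>\<Omega>. (\<epsilon> * g x + (1 - \<epsilon>) * h x) * \<phi> i x) = 0" if "i \<in> I" for i
      using zero[OF that] by (simp add: mom_def)
  qed
qed

section \<open>Correcting a planted law to k-wise independence\<close>

lemma bern_exp_walsh_planted:
  assumes "0 < p" "p < 1" "finite V" "W \<subseteq> V"
  shows "bern_exp p V (\<lambda>B. walsh p W (S \<union> B)) = (if W \<subseteq> S then bern_char p True ^ card W else 0)"
proof -
  have fin: "finite W" using assms finite_subset by blast
  have "bern_exp p V (\<lambda>B. walsh p W (S \<union> B))
        = (\<Prod>v\<in>W. p * bern_char p (v \<in> S \<or> True) + (1 - p) * bern_char p (v \<in> S \<or> False))"
    using bern_exp_prod_subset[OF assms(3,4), of p "\<lambda>v b. bern_char p (v \<in> S \<or> b)"]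
    by (simp add: walsh_def)
  \<comment> \<open>A vertex of \<open>S\<close> is certainly open, while a vertex outside has a
    character of mean zero; one such vertex in \<open>W\<close> kills the whole product.\<close>
  also have "\<dots> = (\<Prod>v\<in>W. if v \<in> S then bern_char p True else 0)"
    using bern_char_moments(1)[OF assms(1,2)] by (intro prod.cong) (auto simp: algebra_simps)
  also have "\<dots> = (if W \<subseteq> S then bern_char p True ^ card W else 0)"
  proof (cases "W \<subseteq> S")
    case True
    then have "(\<Prod>v\<in>W. if v \<in> S then bern_char p True else 0) = (\<Prod>v\<in>W. bern_char p True)"
      by (intro prod.cong) auto
    then show ?thesis using True by simp
  next
    case False
    then show ?thesis using fin by (auto intro!: prod_zero)
  qed
  finally show ?thesis .
qed

text \<open>The index \<open>Y\<close>, drawn from \<nu>, carries the randomness of the planted set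
  \<open>S Y\<close>. The number \<open>K\<close> bounds the L2 norm of the Fourier coefficients of
  degree at most k of the planted law. Increasing functionals of the corrected law lose at most the
  factor \<open>hyp_const p ^ k * K\<close>.\<close>

lemma kwise_law_from_planted:
  fixes V :: "'a set" and \<nu> :: "'b \<Rightarrow> real" and S :: "'b \<Rightarrow> 'a set"
  assumes p: "0 < p" "p < 1" and V: "finite V"
    and J: "finite J" "\<And>Y. Y \<in> J \<Longrightarrow> 0 \<le> \<nu> Y" "sum \<nu> J = 1" "\<And>Y. Y \<in> J \<Longrightarrow> S Y \<subseteq> V"
    and K: "1 < K" "(\<Sum>W | W \<subseteq> V \<and> card W \<le> k. (bern_char p True ^ card W * sum \<nu> {Y \<in> J. W \<subseteq> S Y})\<^sup>2) \<le> K\<^sup>2"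
  obtains w where "\<And>A. A \<subseteq> V \<Longrightarrow> 0 \<le> w A" "sum w (Pow V) = 1"
    and "\<And>W. W \<subseteq> V \<Longrightarrow> W \<noteq> {} \<Longrightarrow> card W \<le> k \<Longrightarrow> (\<Sum>A\<in>Pow V. w A * walsh p W A) = 0"
    and "\<And>F. (\<And>A. A \<subseteq> V \<Longrightarrow> 0 \<le> F A) \<Longrightarrow> (\<And>A B. A \<subseteq> B \<Longrightarrow> B \<subseteq> V \<Longrightarrow> F A \<le> F B) \<Longrightarrow>
       (\<Sum>Y\<in>J. \<nu> Y * F (S Y)) / (hyp_const p ^ k * K) \<le> (\<Sum>A\<in>Pow V. w A * F A)"
proof -
  let ?s = "hyp_const p" and ?m = "bern_char p True"
  define \<epsilon> where "\<epsilon> = 1 / (?s ^ k * K)"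
  have "1 \<le> ?s ^ k" using hyp_const_ge[OF p] by simp
  then have "1 * 1 < ?s ^ k * K" using K(1) by (intro mult_le_less_imp_less) auto
  then have D: "1 < ?s ^ k * K" by simp
  have eps: "0 < \<epsilon>" "\<epsilon> < 1" "\<epsilon> * (?s ^ k * K) = 1"
  proof -
    show "0 < \<epsilon>" "\<epsilon> < 1" using D by (auto simp: \<epsilon>_def)
    show "\<epsilon> * (?s ^ k * K) = 1"
      unfolding \<epsilon>_def by (rule iffD1[OF nonzero_eq_divide_eq refl]) (use D in linarith)
  qed
  \<comment> \<open>The planted law: the union of \<open>S Y\<close> with an independent
    product-distributed set \<open>B\<close>.\<close>
  define g where "g A = (\<Sum>(Y, B) | (Y, B) \<in> J \<times> Pow V \<and> S Y \<union> B = A. \<nu> Y * bern_weight p V B)" for A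
  have g_nonneg: "0 \<le> g A" for A
    unfolding g_def using J(2) p by (intro sum_nonneg) (auto simp: bern_weight_nonneg)
  have Eg: "(\<Sum>A\<in>Pow V. g A * F A) = (\<Sum>Y\<in>J. \<nu> Y * bern_exp p V (\<lambda>B. F (S Y \<union> B)))" for F
  proof -
    let ?h = "\<lambda>z. S (fst z) \<union> snd z" and ?f = "\<lambda>z. \<nu> (fst z) * bern_weight p V (snd z) * F (S (fst z) \<union> snd z)"
    have "(\<Sum>A\<in>Pow V. g A * F A) = (\<Sum>A\<in>Pow V. sum ?f {z \<in> J \<times> Pow V. ?h z = A})"
      unfolding g_def sum_distrib_right by (intro sum.cong) (auto simp: case_prod_unfold)
    also have "\<dots> = sum ?f (J \<times> Pow V)"
      using J V by (intro sum.group) (auto dest: subsetD[OF J(4)])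
    also have "\<dots> = (\<Sum>Y\<in>J. \<nu> Y * bern_exp p V (\<lambda>B. F (S Y \<union> B)))"
      by (simp add: bern_exp_def sum_distrib_left mult.assoc sum.cartesian_product case_prod_unfold)
    finally show ?thesis .
  qed
  \<comment> \<open>The probability that the planted set contains \<open>W\<close>. By
    \<open>bern_exp_walsh_planted\<close> the Fourier coefficient at \<open>W\<close> is this times
    a power of the character of an open vertex.\<close>
  define P where "P W = sum \<nu> {Y \<in> J. W \<subseteq> S Y}" for W
  have Eg_walsh: "(\<Sum>A\<in>Pow V. g A * walsh p W A) = ?m ^ card W * P W" if "W \<subseteq> V" for W
  proof -
    have "(\<Sum>A\<in>Pow V. g A * walsh p W A) = (\<Sum>Y\<in>J. if W \<subseteq> S Y then \<nu> Y * ?m ^ card W else 0)"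
      unfolding Eg bern_exp_walsh_planted[OF p V that] by (intro sum.cong) auto
    also have "\<dots> = (\<Sum>Y | Y \<in> J \<and> W \<subseteq> S Y. \<nu> Y * ?m ^ card W)"
      using J(1) by (simp add: sum.inter_filter)
    finally show ?thesis by (simp add: P_def sum_distrib_left mult.commute)
  qed
  have Eg_one: "sum g (Pow V) = 1"
    using Eg_walsh[of "{}"] J(3) by (simp add: P_def)
  define I where "I = {W. W \<subseteq> V \<and> W \<noteq> {} \<and> card W \<le> k}"
  have I: "finite I" using V by (auto simp: I_def)
  have dual: "\<epsilon> * ((\<Sum>A\<in>Pow V. g A * (\<Sum>W\<in>I. c W * walsh p W A)) - \<beta>) \<le> - \<beta>"
    if lower: "\<And>A. A \<in> Pow V \<Longrightarrow> \<beta> \<le> (\<Sum>W\<in>I. c W * walsh p W A)" for c \<beta>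
  proof -
    \<comment> \<open>Subtracting the lower bound \<beta> gives a nonnegative polynomial of degree
      at most k with these coefficients. Its product-measure mean is -\<beta>, so
      \<open>nonneg_low_degree_norm_le\<close> bounds its norm by a multiple of -\<beta>, and
      Cauchy-Schwarz over the coefficients then bounds its planted mean.\<close>
    define c' where "c' W = (if W = {} then - \<beta> else if card W \<le> k then c W else 0)" for W
    define L where "L = {W. W \<subseteq> V \<and> card W \<le> k}"
    have L: "L = insert {} I" "{} \<notin> I" by (auto simp: I_def L_def)
    have sum_L: "(\<Sum>W\<in>L. c' W * t W) = (\<Sum>W\<in>I. c W * t W) - \<beta> * t {}" for t :: "'a set \<Rightarrow> real"
    proof -
      have "(\<Sum>W\<in>I. c' W * t W) = (\<Sum>W\<in>I. c W * t W)"
        by (intro sum.cong) (auto simp: I_def c'_def)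
      then show ?thesis using L I by (simp add: c'_def)
    qed
    have Pow_L: "(\<Sum>W\<in>Pow V. f W) = (\<Sum>W\<in>L. f W)" if "\<And>W. W \<subseteq> V \<Longrightarrow> k < card W \<Longrightarrow> f W = 0"
      for f :: "'a set \<Rightarrow> real"
      using that V by (intro sum.mono_neutral_right) (auto simp: L_def not_le)
    have c'0: "c' W = 0" if "k < card W" for W using that by (auto simp: c'_def)
    have norm: "sqrt (\<Sum>W\<in>Pow V. (c' W)\<^sup>2) \<le> ?s ^ k * c' {}"
    proof (rule nonneg_low_degree_norm_le[OF p V])
      fix A assume "A \<subseteq> V"
      then have "0 \<le> (\<Sum>W\<in>L. c' W * walsh p W A)" using lower[of A] by (simp add: sum_L)
      also have "\<dots> = (\<Sum>W\<in>Pow V. c' W * walsh p W A)" by (rule Pow_L[symmetric]) (simp add: c'0)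
      finally show "0 \<le> (\<Sum>W\<in>Pow V. c' W * walsh p W A)" .
    qed (rule c'0)
    have "(\<Sum>A\<in>Pow V. g A * (\<Sum>W\<in>I. c W * walsh p W A)) - \<beta>
          = (\<Sum>W\<in>I. c W * (\<Sum>A\<in>Pow V. g A * walsh p W A)) - \<beta>"
      unfolding sum_distrib_left by (subst sum.swap) (simp add: algebra_simps)
    also have "\<dots> = (\<Sum>W\<in>L. c' W * (?m ^ card W * P W))"
      unfolding sum_L using Eg_walsh J(3) by (simp add: I_def P_def)
    also have "\<dots> \<le> sqrt (\<Sum>W\<in>L. (c' W)\<^sup>2) * K"
    proof (rule power2_le_imp_le)
      have "(\<Sum>W\<in>L. c' W * (?m ^ card W * P W))\<^sup>2 \<le> (\<Sum>W\<in>L. (c' W)\<^sup>2) * (\<Sum>W\<in>L. (?m ^ card W * P W)\<^sup>2)"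
        by (rule Cauchy_Schwarz_ineq_sum)
      also have "\<dots> \<le> (\<Sum>W\<in>L. (c' W)\<^sup>2) * K\<^sup>2"
        using K(2) unfolding L_def P_def by (intro mult_left_mono sum_nonneg) auto
      also have "\<dots> = (sqrt (\<Sum>W\<in>L. (c' W)\<^sup>2) * K)\<^sup>2"
        by (simp add: power_mult_distrib sum_nonneg)
      finally show "(\<Sum>W\<in>L. c' W * (?m ^ card W * P W))\<^sup>2 \<le> (sqrt (\<Sum>W\<in>L. (c' W)\<^sup>2) * K)\<^sup>2" .
    qed (use K(1) in \<open>auto intro!: mult_nonneg_nonneg sum_nonneg\<close>)
    also have "\<dots> \<le> ?s ^ k * (- \<beta>) * K"
      using norm K(1) Pow_L[of "\<lambda>W. (c' W)\<^sup>2"] c'0 by (intro mult_right_mono) (auto simp: c'_def)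
    finally have "\<epsilon> * ((\<Sum>A\<in>Pow V. g A * (\<Sum>W\<in>I. c W * walsh p W A)) - \<beta>) \<le> \<epsilon> * (?s ^ k * (- \<beta>) * K)"
      using eps by (intro mult_left_mono) auto
    also have "\<dots> = \<epsilon> * (?s ^ k * K) * (- \<beta>)" by (simp only: mult_ac)
    also have "\<dots> = - \<beta>" unfolding eps(3) by simp
    finally show ?thesis .
  qed
  obtain w where w: "\<And>A. A \<in> Pow V \<Longrightarrow> \<epsilon> * g A \<le> w A" "sum w (Pow V) = 1"
      "\<And>W. W \<in> I \<Longrightarrow> (\<Sum>A\<in>Pow V. w A * walsh p W A) = 0"
    using moment_correction[OF _ I less_imp_le[OF eps(1)] eps(2) g_nonneg Eg_one dual] V
    by blast
  show ?thesis
  proof (rule that[of w])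
    show "0 \<le> w A" if "A \<subseteq> V" for A
      using w(1)[of A] that eps g_nonneg[of A] by (smt (verit) PowI mult_nonneg_nonneg)
    show "sum w (Pow V) = 1" by (rule w)
    show "(\<Sum>A\<in>Pow V. w A * walsh p W A) = 0" if "W \<subseteq> V" "W \<noteq> {}" "card W \<le> k" for W
      using w(3)[of W] that by (simp add: I_def)
    fix F :: "'a set \<Rightarrow> real"
    assume F: "\<And>A. A \<subseteq> V \<Longrightarrow> 0 \<le> F A" "\<And>A B. A \<subseteq> B \<Longrightarrow> B \<subseteq> V \<Longrightarrow> F A \<le> F B"
    \<comment> \<open>Adding the independent open set can only increase a monotone \<open>F\<close>,
      so the planted set alone gives a lower bound.\<close>
    have "F (S Y) \<le> bern_exp p V (\<lambda>B. F (S Y \<union> B))" if "Y \<in> J" for Y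
    proof -
      have "F (S Y) = bern_exp p V (\<lambda>_. F (S Y) * 1)"
        by (simp only: bern_exp_cmult bern_exp_one[OF V])
      also have "\<dots> \<le> bern_exp p V (\<lambda>B. F (S Y \<union> B))"
        using p F(2) J(4)[OF that] by (intro bern_exp_mono) auto
      finally show ?thesis .
    qed
    then have "(\<Sum>Y\<in>J. \<nu> Y * F (S Y)) \<le> (\<Sum>A\<in>Pow V. g A * F A)"
      unfolding Eg using J(2) by (intro sum_mono mult_left_mono) auto
    then have "\<epsilon> * (\<Sum>Y\<in>J. \<nu> Y * F (S Y)) \<le> (\<Sum>A\<in>Pow V. \<epsilon> * g A * F A)"
      using eps by (simp add: mult.assoc flip: sum_distrib_left)
    also have "\<dots> \<le> (\<Sum>A\<in>Pow V. w A * F A)"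
      using w(1) F(1) by (intro sum_mono mult_right_mono) auto
    finally show "(\<Sum>Y\<in>J. \<nu> Y * F (S Y)) / (?s ^ k * K) \<le> (\<Sum>A\<in>Pow V. w A * F A)"
      by (simp add: \<epsilon>_def)
  qed
qed

subsection \<open>The planted cluster\<close>

text \<open>As \<open>prefix\<close> is reflexive and the root is the empty word, for nonempty
  \<open>W\<close> this is the smallest subtree containing the root and \<open>W\<close>. Thus
  \<open>W\<close> lies in the open cluster of the root iff \<open>ancestors W\<close> is
  open.\<close>

definition ancestors :: "'a list set \<Rightarrow> 'a list set" where
  "ancestors W = {u. \<exists>v\<in>W. prefix u v}"

lemma ancestors_single: "ancestors {v} = set (prefixes v)"
  by (auto simp: ancestors_def)

lemma card_ancestors_single: "card (ancestors {v}) = Suc (length v)"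
  by (simp add: ancestors_single distinct_card)

lemma finite_dary_tree_verts: "finite (dary_tree_verts d n)"
proof (rule finite_subset)
  show "dary_tree_verts d n \<subseteq> {v. set v \<subseteq> {..<d} \<and> length v \<le> n}"
    by (auto simp: dary_tree_verts_def)
qed (rule finite_lists_length_le; simp)

lemma ancestors_subset_verts: "W \<subseteq> dary_tree_verts d n \<Longrightarrow> ancestors W \<subseteq> dary_tree_verts d n"
  by (force simp: ancestors_def dary_tree_verts_def subset_eq prefix_def)

lemma dary_tree_verts_0: "dary_tree_verts d 0 = {}"
  by (simp add: dary_tree_verts_def)

text \<open>For r = \<rho>^2 the second factor is the probability that \<open>W\<close> lies in both
  of two independent root clusters of density \<rho>. Summed over \<open>W\<close>, these weights
  control the L2 norm of the planted law.\<close>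

definition span_weight :: "real \<Rightarrow> real \<Rightarrow> 'a list set \<Rightarrow> real" where
  "span_weight x r W = x ^ card W * r ^ card (ancestors W)"

text \<open>Assembles a vertex set from its part at the root and its parts in the d subtrees. Sums
  of \<open>span_weight\<close> then factor over the subtrees.\<close>

definition graft :: "bool \<Rightarrow> (nat \<Rightarrow> nat list set) \<Rightarrow> nat \<Rightarrow> nat list set" where
  "graft b w d = (if b then {[]} else {}) \<union> (\<Union>i<d. (#) i ` w i)"

lemma ancestors_graft:
  assumes "graft b w d \<noteq> {}"
  shows "ancestors (graft b w d) = insert [] (\<Union>i<d. (#) i ` ancestors (w i))"
  using assms by (auto simp: ancestors_def graft_def prefix_Cons split: if_splits)

lemma card_insert_Nil_UN_Cons:
  fixes w :: "nat \<Rightarrow> nat list set"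
  assumes "\<And>i. i < d \<Longrightarrow> finite (w i)"
  shows "card (insert [] (\<Union>i<d. (#) i ` w i)) = Suc (\<Sum>i<d. card (w i))"
    and "card (\<Union>i<d. (#) i ` w i) = (\<Sum>i<d. card (w i))"
proof -
  show *: "card (\<Union>i<d. (#) i ` w i) = (\<Sum>i<d. card (w i))"
    using assms by (subst card_UN_disjoint) (auto simp: card_image)
  have "[] \<notin> (\<Union>i<d. (#) i ` w i)" by auto
  then show "card (insert [] (\<Union>i<d. (#) i ` w i)) = Suc (\<Sum>i<d. card (w i))"
    using * assms by (subst card_insert_disjoint) auto
qed

text \<open>The root is an ancestor of every nonempty set, hence the factor r. The empty set has
  weight 1 while the product formula gives r, hence the correction 1 - r.\<close>

lemma span_weight_graft:
  assumes "\<And>i. i < d \<Longrightarrow> finite (w i)" "\<And>i. i < d \<Longrightarrow> finite (ancestors (w i))"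
  shows "span_weight x r (graft b w d) = r * ((if b then x else 1) * (\<Prod>i<d. span_weight x r (w i)))
           + (if graft b w d = {} then 1 - r else 0)"
proof (cases "graft b w d = {}")
  case True
  then have "\<not> b" "\<And>i. i < d \<Longrightarrow> w i = {}" by (auto simp: graft_def split: if_splits)
  then show ?thesis using True by (simp add: span_weight_def ancestors_def)
next
  case False
  have "card (graft b w d) = (if b then 1 else 0) + (\<Sum>i<d. card (w i))"
    using card_insert_Nil_UN_Cons[OF assms(1)] by (auto simp: graft_def)
  then show ?thesis
    using False card_insert_Nil_UN_Cons(1)[OF assms(2)]
    by (simp add: span_weight_def ancestors_graft[OF False] prod.distrib power_sum power_add)
qed

lemma graft_children:
  assumes "W \<subseteq> dary_tree_verts d n"
  shows "graft ([] \<in> W) (\<lambda>i\<in>{..<d}. {v. i # v \<in> W}) d = W"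
proof (rule set_eqI)
  fix u
  have "i < d" if "i # v \<in> W" for i v using assms that by (auto simp: dary_tree_verts_def)
  then show "u \<in> graft ([] \<in> W) (\<lambda>i\<in>{..<d}. {v. i # v \<in> W}) d \<longleftrightarrow> u \<in> W"
    by (cases u) (auto simp: graft_def)
qed

lemma sum_span_weight_Suc:
  "(\<Sum>W\<in>Pow (dary_tree_verts d (Suc n)). span_weight x r W)
   = r * ((1 + x) * (\<Sum>W\<in>Pow (dary_tree_verts d n). span_weight x r W) ^ d) + (1 - r)"
proof -
  let ?V = "dary_tree_verts d n" and ?E = "PiE {..<d} (\<lambda>_. Pow (dary_tree_verts d n))"
  \<comment> \<open>Among the extensional families, this one with the root absent is the only choice
    that grafts to the empty set, so the correction 1 - r is counted exactly once.\<close>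
  let ?w0 = "\<lambda>i\<in>{..<d}. {}"
  have finE: "finite ?E" by (intro finite_PiE) (auto simp: finite_dary_tree_verts)
  have empty: "(if graft b w d = {} then 1 - r else 0) = (if (b, w) = (False, ?w0) then 1 - r else 0)"
    if "w \<in> ?E" for b w
  proof -
    have "graft b w d = {} \<longleftrightarrow> (b, w) = (False, ?w0)"
      using that by (auto simp: graft_def PiE_def extensional_def fun_eq_iff split: if_splits)
    then show ?thesis by simp
  qed
  have "(\<Sum>W\<in>Pow (dary_tree_verts d (Suc n)). span_weight x r W)
        = (\<Sum>(b, w)\<in>UNIV \<times> ?E. span_weight x r (graft b w d))"
    by (rule sum.reindex_bij_witness[where i = "\<lambda>(b, w). graft b w d"
          and j = "\<lambda>W. ([] \<in> W, \<lambda>i\<in>{..<d}. {v. i # v \<in> W})"])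
      (auto simp: graft_children, auto simp: graft_def dary_tree_verts_def PiE_def extensional_def
        fun_eq_iff Pi_def subset_eq split: if_splits)
  also have "\<dots> = (\<Sum>(b, w)\<in>UNIV \<times> ?E. r * ((if b then x else 1) * (\<Prod>i<d. span_weight x r (w i)))
           + (if (b, w) = (False, ?w0) then 1 - r else 0))"
  proof (intro sum.cong refl, clarify)
    fix b w assume w: "w \<in> ?E"
    have "finite (w i)" "finite (ancestors (w i))" if "i < d" for i
      using w that finite_dary_tree_verts[of d n] ancestors_subset_verts[of "w i" d n]
      by (auto intro: finite_subset)
    then show "span_weight x r (graft b w d) = r * ((if b then x else 1) * (\<Prod>i<d. span_weight x r (w i)))
           + (if (b, w) = (False, ?w0) then 1 - r else 0)"
      using span_weight_graft[of d w x r b] empty[OF w, of b] by simp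
  qed
  also have "\<dots> = r * (\<Sum>(b, w)\<in>UNIV \<times> ?E. (if b then x else 1) * (\<Prod>i<d. span_weight x r (w i)))
      + (\<Sum>z\<in>UNIV \<times> ?E. if z = (False, ?w0) then 1 - r else 0)"
    by (simp add: case_prod_unfold prod_eq_iff sum.distrib sum_distrib_left)
  also have "(\<Sum>z\<in>UNIV \<times> ?E. if z = (False, ?w0) then 1 - r else 0) = 1 - r"
    using finE by (subst sum.delta) auto
  also have "(\<Sum>(b, w)\<in>UNIV \<times> ?E. (if b then x else 1) * (\<Prod>i<d. span_weight x r (w i)))
      = (\<Sum>b\<in>UNIV. if b then x else 1) * (\<Sum>w\<in>?E. \<Prod>i<d. span_weight x r (w i))"
    by (simp add: sum_product sum.cartesian_product)
  also have "(\<Sum>w\<in>?E. \<Prod>i<d. span_weight x r (w i)) = (\<Prod>i<d. \<Sum>W\<in>Pow ?V. span_weight x r W)"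
    by (intro prod_sum_PiE[symmetric]) (auto simp: finite_dary_tree_verts)
  finally show ?thesis by (simp add: UNIV_bool add.commute)
qed

text \<open>The intersection of two independent root clusters has mean offspring d \<rho>^2 = 36 /
  (25 d) \<le> 18 / 25. This leaves room for the factor 1 + 1/50 in the recursion of
  \<open>sum_span_weight_Suc\<close>, which therefore preserves the bound for all n.\<close>

lemma sum_span_weight_le:
  assumes "2 \<le> d"
  shows "(\<Sum>W\<in>Pow (dary_tree_verts d n). span_weight (1 / 50) ((6 / (5 * real d))\<^sup>2) W) \<le> 1 + 1 / (10 * real d)"
    (is "?F n \<le> _")
proof (induction n)
  case 0
  show ?case by (simp add: dary_tree_verts_0 span_weight_def ancestors_def)
next
  case (Suc n)
  let ?r = "(6 / (5 * real d))\<^sup>2"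
  have d: "2 \<le> real d" using assms by simp
  have "0 \<le> ?F n" by (intro sum_nonneg) (simp add: span_weight_def)
  then have "?F n ^ d \<le> (1 + 1 / (10 * real d)) ^ d"
    using Suc.IH by (intro power_mono) auto
  also have "\<dots> \<le> exp (1 / (10 * real d)) ^ d"
    by (intro power_mono) (auto simp: exp_ge_add_one_self)
  also have "\<dots> = exp (1 / 10)"
    using d by (simp flip: exp_of_nat_mult)
  also have "\<dots> \<le> 111 / 100"
    using exp_bound[of "1 / 10"] by (simp add: power2_eq_square)
  finally have "?F n ^ d \<le> 111 / 100" .
  then have "?F (Suc n) \<le> ?r * ((1 + 1 / 50) * (111 / 100)) + (1 - ?r)"
    unfolding sum_span_weight_Suc by (intro add_mono mult_left_mono) auto
  \<comment> \<open>The excess is 51/50 * 111/100 - 1 = 661/5000; since r is of order 1 / d^2, the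
    next inequality needs only d \<ge> 2.\<close>
  also have "\<dots> = 1 + ?r * (661 / 5000)" by (simp add: algebra_simps)
  also have "?r * (661 / 5000) \<le> 1 / (10 * real d)"
    using d by (simp add: field_simps power2_eq_square)
  finally show ?case by simp
qed

section \<open>The law on the tree\<close>

definition open_leaves :: "nat \<Rightarrow> nat \<Rightarrow> nat list set \<Rightarrow> nat list set" where
  "open_leaves d n A = {l \<in> dary_tree_leaves d n. ancestors {l} \<subseteq> A}"

lemma finite_dary_tree_leaves: "finite (dary_tree_leaves d n)"
  using finite_dary_tree_verts[of d n] by (simp add: dary_tree_leaves_def)

lemma card_dary_tree_leaves: "0 < n \<Longrightarrow> card (dary_tree_leaves d n) = d ^ (n - 1)"
proof -
  assume "0 < n"
  then have "dary_tree_leaves d n = {v. set v \<subseteq> {..<d} \<and> length v = n - 1}"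
    by (auto simp: dary_tree_leaves_def dary_tree_verts_def)
  then show ?thesis by (simp add: card_lists_length_eq)
qed

lemma bern_exp_superset:
  assumes "finite V" "U \<subseteq> V"
  shows "bern_exp p V (\<lambda>A. of_bool (U \<subseteq> A)) = p ^ card U"
proof -
  have "finite U" using assms finite_subset by blast
  then have "(\<Prod>v\<in>U. if v \<in> A then 1 else 0 :: real) = of_bool (U \<subseteq> A)" for A :: "'a set"
    by (cases "U \<subseteq> A") (auto simp: subset_eq intro: prod.neutral)
  then show ?thesis
    using bern_exp_prod_subset[OF assms, of p "\<lambda>_ b. if b then 1 else 0"] by simp
qed

lemma kwise_law_on_tree:
  fixes p :: real
  assumes p: "0 < p" "p < 1" and d: "2 \<le> d" and n: "0 < n"
  defines "V \<equiv> dary_tree_verts d n"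
  defines "N \<equiv> 1 + 50 * (bern_char p True)\<^sup>2"
  obtains w where "\<And>A. A \<subseteq> V \<Longrightarrow> 0 \<le> w A" "sum w (Pow V) = 1"
    and "\<And>W. W \<subseteq> V \<Longrightarrow> W \<noteq> {} \<Longrightarrow> card W \<le> k \<Longrightarrow> (\<Sum>A\<in>Pow V. w A * walsh p W A) = 0"
    and "(6 / 5) ^ n / real d / (2 * (hyp_const p * N) ^ k) \<le> (\<Sum>A\<in>Pow V. w A * real (card (open_leaves d n A)))"
proof -
  let ?m = "bern_char p True"
  \<comment> \<open>The planted cluster is supercritical, with mean offspring d \<rho> = 6/5, while
    its density is small enough for \<open>sum_span_weight_le\<close>.\<close>
  define \<rho> where "\<rho> = 6 / (5 * real d)"
  have \<rho>: "0 < \<rho>" "\<rho> \<le> 1" "real d * \<rho> = 6 / 5" using d by (auto simp: \<rho>_def field_simps)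
  have V: "finite V" unfolding V_def by (rule finite_dary_tree_verts)
  \<comment> \<open>The open cluster of the root in the configuration \<open>Y\<close>.\<close>
  define S where "S Y = {v \<in> V. ancestors {v} \<subseteq> Y}" for Y
  have S_iff: "W \<subseteq> S Y \<longleftrightarrow> ancestors W \<subseteq> Y" if "W \<subseteq> V" for W Y
    using that by (auto simp: S_def ancestors_def)
  have prob: "sum (bern_weight \<rho> V) {Y \<in> Pow V. W \<subseteq> S Y} = \<rho> ^ card (ancestors W)" if "W \<subseteq> V" for W
  proof -
    have "sum (bern_weight \<rho> V) {Y \<in> Pow V. W \<subseteq> S Y} = bern_exp \<rho> V (\<lambda>Y. of_bool (ancestors W \<subseteq> Y))"
      unfolding bern_exp_def S_iff[OF that] sum.inter_filter[OF finite_Pow_iff[THEN iffD2, OF V]]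
      by (intro sum.cong refl) simp
    then show ?thesis
      using bern_exp_superset[OF V] ancestors_subset_verts that by (simp add: V_def)
  qed
  \<comment> \<open>Each vertex of \<open>W\<close> contributes at most N / 50. The factor 1/50
    feeds the subcritical sum, and the powers of N cost at most \<open>N ^ k\<close> because
    \<open>card W \<le> k\<close>.\<close>
  have N: "1 \<le> N" "?m\<^sup>2 \<le> N / 50" by (auto simp: N_def)
  have "(\<Sum>W | W \<subseteq> V \<and> card W \<le> k. (?m ^ card W * sum (bern_weight \<rho> V) {Y \<in> Pow V. W \<subseteq> S Y})\<^sup>2)
      \<le> (\<Sum>W | W \<subseteq> V \<and> card W \<le> k. N ^ k * span_weight (1 / 50) (\<rho>\<^sup>2) W)"
  proof (intro sum_mono)
    fix W assume "W \<in> {W. W \<subseteq> V \<and> card W \<le> k}"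
    then have W: "W \<subseteq> V" "card W \<le> k" by auto
    have "(?m\<^sup>2) ^ card W \<le> (N / 50) ^ card W" using N by (intro power_mono) auto
    also have "\<dots> \<le> N ^ k * (1 / 50) ^ card W"
      unfolding power_divide using W(2) N(1) by (simp add: divide_right_mono power_increasing)
    finally have "(?m\<^sup>2) ^ card W * (\<rho>\<^sup>2) ^ card (ancestors W)
        \<le> N ^ k * (1 / 50) ^ card W * (\<rho>\<^sup>2) ^ card (ancestors W)"
      by (intro mult_right_mono) auto
    then show "(?m ^ card W * sum (bern_weight \<rho> V) {Y \<in> Pow V. W \<subseteq> S Y})\<^sup>2
        \<le> N ^ k * span_weight (1 / 50) (\<rho>\<^sup>2) W"
      unfolding prob[OF W(1)] by (simp add: span_weight_def power_mult_distrib mult.assoc flip: power_mult power_even_eq)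
        (simp add: mult.commute power_mult)
  qed
  also have "\<dots> \<le> (\<Sum>W\<in>Pow V. N ^ k * span_weight (1 / 50) (\<rho>\<^sup>2) W)"
    using V N(1) by (intro sum_mono2) (auto simp: span_weight_def)
  also have "\<dots> = N ^ k * (\<Sum>W\<in>Pow V. span_weight (1 / 50) (\<rho>\<^sup>2) W)"
    by (simp add: sum_distrib_left)
  also have "\<dots> \<le> N ^ k * (1 + 1 / (10 * real d))"
    using sum_span_weight_le[OF d, of n] N(1) unfolding V_def \<rho>_def by (intro mult_left_mono) auto
  also have "\<dots> \<le> N ^ k * 2" using d N(1) by (intro mult_left_mono) (auto simp: field_simps)
  \<comment> \<open>The factor 2 also makes \<open>K\<close> exceed 1 strictly, as
    \<open>kwise_law_from_planted\<close> requires.\<close>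
  also have "\<dots> \<le> (2 * N ^ k)\<^sup>2"
    using one_le_power[OF N(1), of k] by (simp add: power2_eq_square mult_le_cancel_left1 flip: mult.assoc)
  finally have K: "(\<Sum>W | W \<subseteq> V \<and> card W \<le> k. (?m ^ card W * sum (bern_weight \<rho> V) {Y \<in> Pow V. W \<subseteq> S Y})\<^sup>2)
      \<le> (2 * N ^ k)\<^sup>2" .
  obtain w where w: "\<And>A. A \<subseteq> V \<Longrightarrow> 0 \<le> w A" "sum w (Pow V) = 1"
      "\<And>W. W \<subseteq> V \<Longrightarrow> W \<noteq> {} \<Longrightarrow> card W \<le> k \<Longrightarrow> (\<Sum>A\<in>Pow V. w A * walsh p W A) = 0"
      "\<And>F. (\<And>A. A \<subseteq> V \<Longrightarrow> 0 \<le> F A) \<Longrightarrow> (\<And>A B. A \<subseteq> B \<Longrightarrow> B \<subseteq> V \<Longrightarrow> F A \<le> F B) \<Longrightarrow>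
       (\<Sum>Y\<in>Pow V. bern_weight \<rho> V Y * F (S Y)) / (hyp_const p ^ k * (2 * N ^ k)) \<le> (\<Sum>A\<in>Pow V. w A * F A)"
  proof (rule kwise_law_from_planted[OF p V, of "Pow V" "bern_weight \<rho> V" S "2 * N ^ k" k])
    show "sum (bern_weight \<rho> V) (Pow V) = 1"
      using bern_exp_one[OF V, of \<rho>] by (simp add: bern_exp_def)
    show "1 < 2 * N ^ k" using one_le_power[OF N(1), of k] by simp
    show "S Y \<subseteq> V" for Y by (auto simp: S_def)
  qed (use V \<rho> K in \<open>auto simp: bern_weight_nonneg\<close>)
  let ?F = "\<lambda>A. real (card (open_leaves d n A))"
  have "(\<Sum>Y\<in>Pow V. bern_weight \<rho> V Y * ?F (S Y)) = (6 / 5) ^ n / real d"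
  proof -
    have leaf: "{l} \<subseteq> V" "ancestors {l} \<subseteq> V" "card (ancestors {l}) = n" if "l \<in> dary_tree_leaves d n" for l
      using that ancestors_subset_verts[of "{l}" d n]
      by (auto simp: V_def dary_tree_leaves_def card_ancestors_single)
    \<comment> \<open>A leaf has all its ancestors in the cluster iff it has them all in
      \<open>Y\<close>, so its probability is \<rho>^n, one factor per level.\<close>
    have anc: "ancestors {l} \<subseteq> S Y \<longleftrightarrow> ancestors {l} \<subseteq> Y" if "l \<in> dary_tree_leaves d n" for l Y
    proof -
      have "ancestors (ancestors {l}) = ancestors {l}"
        by (auto simp: ancestors_def intro: prefix_order.trans)
      then show ?thesis using S_iff[OF leaf(2)[OF that]] by simp
    qed
    have "?F (S Y) = (\<Sum>l\<in>dary_tree_leaves d n. of_bool (ancestors {l} \<subseteq> Y))" for Y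
    proof -
      have "open_leaves d n (S Y) = {l \<in> dary_tree_leaves d n. ancestors {l} \<subseteq> Y}"
        using anc by (auto simp: open_leaves_def)
      then show ?thesis using finite_dary_tree_leaves[of d n]
        by (simp add: of_bool_def sum.If_cases Int_def)
    qed
    then have "(\<Sum>Y\<in>Pow V. bern_weight \<rho> V Y * ?F (S Y))
        = (\<Sum>l\<in>dary_tree_leaves d n. bern_exp \<rho> V (\<lambda>Y. of_bool (ancestors {l} \<subseteq> Y)))"
      unfolding bern_exp_sum[symmetric] by (simp add: bern_exp_def)
    also have "\<dots> = (\<Sum>l\<in>dary_tree_leaves d n. \<rho> ^ n)"
      using leaf bern_exp_superset[OF V] by (intro sum.cong) auto
    also have "\<dots> = real d ^ (n - 1) * \<rho> ^ n"
      using card_dary_tree_leaves[OF n, of d] by simp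
    also have "\<dots> = (real d * \<rho>) ^ n / real d"
      using d n by (cases n) (auto simp: power_mult_distrib)
    finally show ?thesis by (simp add: \<rho>(3))
  qed
  moreover have "(\<Sum>Y\<in>Pow V. bern_weight \<rho> V Y * ?F (S Y)) / (hyp_const p ^ k * (2 * N ^ k))
      \<le> (\<Sum>A\<in>Pow V. w A * ?F A)"
  proof (rule w(4))
    show "?F A \<le> ?F B" if "A \<subseteq> B" for A B
      using that finite_dary_tree_leaves[of d n]
      by (auto simp: open_leaves_def intro!: card_mono)
  qed auto
  moreover have "hyp_const p ^ k * (2 * N ^ k) = 2 * (hyp_const p * N) ^ k"
    by (simp add: power_mult_distrib)
  ultimately show ?thesis using that[of w] w(1-3) by simp
qed

subsection \<open>Percolations from weights on vertex sets\<close>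

text \<open>A function of one binary state is affine in its character, so the product over
  \<open>J\<close> expands into characters of degree at most k. Only the constant one survives, as
  under the product measure.\<close>

lemma kwise_expectation_prod:
  fixes h :: "'a \<Rightarrow> bool \<Rightarrow> real"
  assumes p: "0 < p" "p < 1" and V: "finite V" and w: "sum w (Pow V) = 1"
    and moments: "\<And>W. W \<subseteq> V \<Longrightarrow> W \<noteq> {} \<Longrightarrow> card W \<le> k \<Longrightarrow> (\<Sum>A\<in>Pow V. w A * walsh p W A) = 0"
    and J: "J \<subseteq> V" "card J \<le> k"
  shows "(\<Sum>A\<in>Pow V. w A * (\<Prod>v\<in>J. h v (v \<in> A))) = (\<Prod>v\<in>J. p * h v True + (1 - p) * h v False)"
proof -
  let ?x = "bern_char p True" and ?y = "bern_char p False"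
  have fin: "finite J" using J V finite_subset by blast
  have "0 < ?x" "?y < 0" using p by (auto simp: bern_char_def)
  then have xy: "?x - ?y \<noteq> 0" by simp
  define \<alpha> where "\<alpha> v = p * h v True + (1 - p) * h v False" for v
  \<comment> \<open>The slope in the character variable; the intercept is the mean \<alpha>, because
    the character is centred.\<close>
  define \<beta> where "\<beta> v = (h v True - h v False) / (?x - ?y)" for v
  have "?x / (?x - ?y) = 1 - p" "?y / (?x - ?y) = - p"
    using bern_char_moments(1)[OF p] xy by (auto simp: field_simps)
  moreover have "\<beta> v * c = (h v True - h v False) * (c / (?x - ?y))" for v c
    by (simp add: \<beta>_def)
  ultimately have "\<beta> v * ?x = (h v True - h v False) * (1 - p)" "\<beta> v * ?y = (h v True - h v False) * (- p)" for v
    by (simp_all only:)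
  then have affine: "h v b = \<beta> v * bern_char p b + \<alpha> v" for v b
    by (cases b) (auto simp: \<alpha>_def algebra_simps)
  have "(\<Sum>A\<in>Pow V. w A * (\<Prod>v\<in>J. h v (v \<in> A)))
        = (\<Sum>A\<in>Pow V. \<Sum>U\<in>Pow J. (prod \<beta> U * prod \<alpha> (J - U)) * (w A * walsh p U A))"
    unfolding affine prod_add[OF fin] by (simp add: prod.distrib walsh_def sum_distrib_left algebra_simps)
  also have "\<dots> = (\<Sum>U\<in>Pow J. (prod \<beta> U * prod \<alpha> (J - U)) * (\<Sum>A\<in>Pow V. w A * walsh p U A))"
    by (subst sum.swap) (simp add: sum_distrib_left)
  also have "\<dots> = (\<Sum>U\<in>Pow J. if U = {} then prod \<alpha> J else 0)"
  proof (intro sum.cong refl)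
    fix U assume "U \<in> Pow J"
    then have "U \<subseteq> V" "card U \<le> k" using J fin card_mono[of J U] by auto
    then show "(prod \<beta> U * prod \<alpha> (J - U)) * (\<Sum>A\<in>Pow V. w A * walsh p U A)
        = (if U = {} then prod \<alpha> J else 0)"
      using moments[of U] w by auto
  qed
  also have "\<dots> = prod \<alpha> J" using fin by simp
  finally show ?thesis by (simp add: \<alpha>_def)
qed

lemma kwise_percolation_of_weights:
  fixes G :: "('v, 'e) pre_digraph"
  assumes p: "0 < p" "p < 1" and V: "finite (verts G)"
    and w: "\<And>A. A \<subseteq> verts G \<Longrightarrow> 0 \<le> w A" "sum w (Pow (verts G)) = 1"
    and moments: "\<And>W. W \<subseteq> verts G \<Longrightarrow> W \<noteq> {} \<Longrightarrow> card W \<le> k \<Longrightarrow>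
                    (\<Sum>A\<in>Pow (verts G). w A * walsh p W A) = 0"
    and k: "1 \<le> k"
  obtains Q where "Q \<in> kwise_indep_percolations G k p"
    and "\<And>F :: ('v \<Rightarrow> bool) \<Rightarrow> real.
           prob_space.expectation Q F = (\<Sum>A\<in>Pow (verts G). w A * F (\<lambda>v\<in>verts G. v \<in> A))"
proof -
  let ?V = "verts G"
  let ?\<Omega> = "PiE ?V (\<lambda>_. UNIV :: bool set)"
  define u where "u \<omega> = w {v \<in> ?V. \<omega> v}" for \<omega>
  define Q where "Q = point_measure ?\<Omega> (\<lambda>\<omega>. ennreal (u \<omega>))"
  have fin: "finite ?\<Omega>" using V by (intro finite_PiE) auto
  have u: "0 \<le> u \<omega>" for \<omega> using w(1) by (auto simp: u_def)
  have space: "space Q = ?\<Omega>" and sets: "sets Q = Pow ?\<Omega>"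
    by (simp_all add: Q_def space_point_measure sets_point_measure)
  have reindex: "(\<Sum>\<omega>\<in>?\<Omega>. u \<omega> * F \<omega>) = (\<Sum>A\<in>Pow ?V. w A * F (\<lambda>v\<in>?V. v \<in> A))"
    for F :: "('v \<Rightarrow> bool) \<Rightarrow> real"
    proof (rule sum.reindex_bij_witness[where i = "\<lambda>A. \<lambda>v\<in>?V. v \<in> A" and j = "\<lambda>\<omega>. {v \<in> ?V. \<omega> v}"])
      fix \<omega> assume "\<omega> \<in> ?\<Omega>"
      then have "(\<lambda>v\<in>?V. v \<in> {v \<in> ?V. \<omega> v}) = \<omega>"
        by (auto simp: PiE_def extensional_def fun_eq_iff)
      then show "(\<lambda>v\<in>?V. v \<in> {v \<in> ?V. \<omega> v}) = \<omega>"
        "w {v \<in> ?V. \<omega> v} * F (\<lambda>v\<in>?V. v \<in> {v \<in> ?V. \<omega> v}) = u \<omega> * F \<omega>"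
        by (simp_all add: u_def)
    qed auto
  then have integral: "integral\<^sup>L Q F = (\<Sum>A\<in>Pow ?V. w A * F (\<lambda>v\<in>?V. v \<in> A))"
    for F :: "('v \<Rightarrow> bool) \<Rightarrow> real"
    unfolding Q_def using fin u by (simp add: lebesgue_integral_point_measure_finite)
  have "emeasure Q (space Q) = ennreal (\<Sum>\<omega>\<in>?\<Omega>. u \<omega>)"
    unfolding space unfolding Q_def using fin u by (simp add: emeasure_point_measure_finite sum_ennreal)
  moreover have "(\<Sum>\<omega>\<in>?\<Omega>. u \<omega>) = 1"
    using reindex[of "\<lambda>_. 1"] w(2) by simp
  ultimately interpret prob_space Q by (intro prob_spaceI) simp
  \<comment> \<open>Every cylinder on at most k vertices has its product-measure probability.
    Singletons give the marginals, which is where \<open>1 \<le> k\<close> enters, and larger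
    \<open>J\<close> give independence.\<close>
  have cylinder: "prob {\<omega> \<in> space Q. \<forall>v\<in>J. \<omega> v \<in> B v}
      = (\<Prod>v\<in>J. p * of_bool (True \<in> B v) + (1 - p) * of_bool (False \<in> B v))"
    if J: "J \<subseteq> ?V" "card J \<le> k" for J B
  proof -
    have "finite J" using J V finite_subset by blast
    then have ind: "indicator {\<omega> \<in> space Q. \<forall>v\<in>J. \<omega> v \<in> B v} (\<lambda>v\<in>?V. v \<in> A)
        = (\<Prod>v\<in>J. of_bool ((v \<in> A) \<in> B v) :: real)" for A
    proof (cases "\<forall>v\<in>J. (v \<in> A) \<in> B v")
      case True
      then show ?thesis using J(1) by (simp add: indicator_def space subset_eq)
    next
      case False
      then have "\<exists>v\<in>J. of_bool ((v \<in> A) \<in> B v) = (0 :: real)" by auto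
      then have "(\<Prod>v\<in>J. of_bool ((v \<in> A) \<in> B v) :: real) = 0"
        using \<open>finite J\<close> by (intro prod_zero)
      moreover have "\<not> (\<forall>v\<in>J. (\<lambda>v\<in>?V. v \<in> A) v \<in> B v)" using False J(1) by (auto simp: subset_eq)
      ultimately show ?thesis by (simp add: indicator_def)
    qed
    have "{\<omega> \<in> space Q. \<forall>v\<in>J. \<omega> v \<in> B v} \<inter> space Q = {\<omega> \<in> space Q. \<forall>v\<in>J. \<omega> v \<in> B v}"
      by blast
    then have "prob {\<omega> \<in> space Q. \<forall>v\<in>J. \<omega> v \<in> B v}
        = expectation (indicator {\<omega> \<in> space Q. \<forall>v\<in>J. \<omega> v \<in> B v})"
      by (simp only: Bochner_Integration.integral_indicator)
    also have "\<dots> = (\<Sum>A\<in>Pow ?V. w A * (\<Prod>v\<in>J. of_bool ((v \<in> A) \<in> B v)))"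
      unfolding integral ind ..
    also have "\<dots> = (\<Prod>v\<in>J. p * of_bool (True \<in> B v) + (1 - p) * of_bool (False \<in> B v))"
      by (rule kwise_expectation_prod[OF p V w(2) moments J])
    finally show ?thesis .
  qed
  have indep: "indep_vars (\<lambda>_. count_space UNIV) (\<lambda>v \<omega>. \<omega> v) W"
    if W: "W \<subseteq> ?V" "finite W" "card W \<le> k" for W
    unfolding indep_vars_def2
  proof (intro conjI ballI indep_setsI)
    show "(\<lambda>\<omega>. \<omega> v) \<in> measurable Q (count_space UNIV)" for v
      by (simp add: Q_def)
    show "{(\<lambda>\<omega>. \<omega> v) -` A \<inter> space Q |A. A \<in> Sigma_Algebra.sets (count_space UNIV)} \<subseteq> events" for v
      by (auto simp: sets space)
    fix E J
    assume J: "J \<noteq> {}" "J \<subseteq> W" "finite J"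
      and E: "\<forall>j\<in>J. E j \<in> {(\<lambda>\<omega>. \<omega> j) -` A \<inter> space Q |A. A \<in> Sigma_Algebra.sets (count_space UNIV)}"
    have "\<forall>j\<in>J. \<exists>B. E j = {\<omega> \<in> space Q. \<omega> j \<in> B}"
    proof
      fix j assume "j \<in> J"
      with E obtain A where "E j = (\<lambda>\<omega>. \<omega> j) -` A \<inter> space Q" by blast
      then have "E j = {\<omega> \<in> space Q. \<omega> j \<in> A}" by (simp only:) blast
      then show "\<exists>B. E j = {\<omega> \<in> space Q. \<omega> j \<in> B}" ..
    qed
    from bchoice[OF this] obtain B where B: "\<And>j. j \<in> J \<Longrightarrow> E j = {\<omega> \<in> space Q. \<omega> j \<in> B j}"
      by blast
    have "card J \<le> k" "J \<subseteq> ?V" using J W card_mono[of W J] by auto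
    moreover have "(\<Inter>j\<in>J. E j) = {\<omega> \<in> space Q. \<forall>v\<in>J. \<omega> v \<in> B v}" using B J(1) by auto
    moreover have "prob (E j) = p * of_bool (True \<in> B j) + (1 - p) * of_bool (False \<in> B j)" if "j \<in> J" for j
      using cylinder[of "{j}" B] B[OF that] \<open>J \<subseteq> ?V\<close> that k by auto
    ultimately show "prob (\<Inter>j\<in>J. E j) = (\<Prod>j\<in>J. prob (E j))"
      using cylinder[of J B] by simp
  qed
  have marginal: "prob {\<omega> \<in> space Q. \<omega> v} = p" if "v \<in> ?V" for v
    using cylinder[of "{v}" "\<lambda>_. {True}"] that k by simp
  have "Sigma_Algebra.sets (PiM ?V (\<lambda>_. count_space (UNIV :: bool set))) = Pow ?\<Omega>"
    using V by (subst count_space_PiM_finite) auto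
  then have "Q \<in> kwise_indep_percolations G k p"
    using indep marginal prob_space_axioms
    by (auto simp: kwise_indep_percolations_def percolations_def sets)
  then show ?thesis using that integral by blast
qed

subsection \<open>Open paths\<close>

definition root_path :: "'a list \<Rightarrow> ('a list \<times> 'a list) list" where
  "root_path l = map (\<lambda>i. (take i l, take (Suc i) l)) [0..<length l]"

lemma fin_digraph_dary_tree: "fin_digraph (dary_tree d n)"
proof (rule fin_digraph.intro)
  show "wf_digraph (dary_tree d n)"
    by unfold_locales (auto simp: dary_tree_def)
  have "arcs (dary_tree d n) \<subseteq> dary_tree_verts d n \<times> dary_tree_verts d n"
    by (auto simp: dary_tree_def)
  then have "finite (arcs (dary_tree d n))"
    using finite_dary_tree_verts finite_subset by blast
  then show "fin_digraph_axioms (dary_tree d n)"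
    by unfold_locales (auto simp: dary_tree_def finite_dary_tree_verts)
qed

lemma awalk_verts_root_path:
  "pre_digraph.awalk_verts (dary_tree d n) [] (root_path l) = map (\<lambda>i. take i l) [0..<Suc (length l)]"
  unfolding pre_digraph.awalk_verts_conv
  \<comment> \<open>The walk is empty exactly for the empty word; otherwise the final vertex is the
    head of the last arc, exposed by splitting off the last letter.\<close>
  by (cases l rule: rev_cases) (auto simp: root_path_def dary_tree_def comp_def)

lemma cas_root_path: "pre_digraph.cas (dary_tree d n) [] (root_path l) l"
proof -
  \<comment> \<open>Generalised to segments between two prefixes, so that induction can lower the
    starting point.\<close>
  have "pre_digraph.cas (dary_tree d n) (take j l) (map (\<lambda>i. (take i l, take (Suc i) l)) [j..<m]) (take m l)"
    if "j \<le> m" for j m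
    using that
  proof (induction rule: inc_induct)
    case base
    show ?case by (simp add: pre_digraph.cas.simps)
  next
    case (step j)
    then show ?case
      by (subst upt_conv_Cons) (auto simp: pre_digraph.cas.simps dary_tree_def)
  qed
  from this[of 0 "length l"] show ?thesis by (simp add: root_path_def)
qed

lemma apath_root_path:
  assumes "l \<in> dary_tree_verts d n"
  shows "pre_digraph.apath (dary_tree d n) [] (root_path l) l"
proof -
  have "[] \<in> verts (dary_tree d n)" using assms by (auto simp: dary_tree_def dary_tree_verts_def)
  moreover have "set (root_path l) \<subseteq> arcs (dary_tree d n)"
    using assms by (auto simp: root_path_def dary_tree_def dary_tree_verts_def take_Suc_conv_app_nth
        subset_eq dest: in_set_takeD)
  moreover have "distinct (map (\<lambda>i. take i l) [0..<Suc (length l)])"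
    unfolding distinct_map
    by (intro conjI distinct_upt inj_on_inverseI[where g = length]) auto
  ultimately show ?thesis
    using cas_root_path[of d n l]
    unfolding pre_digraph.apath_def pre_digraph.awalk_def awalk_verts_root_path by blast
qed

text \<open>The last vertex of the root path recovers the leaf, so distinct leaves give distinct
  paths. Finiteness of the target matters because \<open>card\<close> of an infinite set is
  0.\<close>

lemma card_open_leaves_le:
  "card (open_leaves d n A) \<le> card (open_root_leaf_paths d n (\<lambda>v\<in>dary_tree_verts d n. v \<in> A))"
proof (rule card_inj_on_le)
  show "inj_on root_path (open_leaves d n A)"
  proof (rule inj_on_inverseI)
    show "last (pre_digraph.awalk_verts (dary_tree d n) [] (root_path l)) = l" for l
      unfolding awalk_verts_root_path by simp
  qed
  show "root_path ` open_leaves d n A \<subseteq> open_root_leaf_paths d n (\<lambda>v\<in>dary_tree_verts d n. v \<in> A)"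
  proof
    fix q assume "q \<in> root_path ` open_leaves d n A"
    then obtain l where l: "q = root_path l" "l \<in> dary_tree_leaves d n" "ancestors {l} \<subseteq> A"
      by (auto simp: open_leaves_def)
    then have lV: "l \<in> dary_tree_verts d n" by (simp add: dary_tree_leaves_def)
    have "set (pre_digraph.awalk_verts (dary_tree d n) [] q) \<subseteq> ancestors {l}"
      unfolding l(1) awalk_verts_root_path by (auto simp: ancestors_def take_is_prefix)
    moreover have "ancestors {l} \<subseteq> dary_tree_verts d n"
      using lV by (intro ancestors_subset_verts) auto
    ultimately show "q \<in> open_root_leaf_paths d n (\<lambda>v\<in>dary_tree_verts d n. v \<in> A)"
      using l apath_root_path[OF lV] by (auto simp: open_root_leaf_paths_def subset_eq)
  qed
  have "open_root_leaf_paths d n \<omega> \<subseteq> (\<Union>l\<in>dary_tree_leaves d n. {q. pre_digraph.apath (dary_tree d n) [] q l})" for \<omega>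
    by (auto simp: open_root_leaf_paths_def)
  then show "finite (open_root_leaf_paths d n (\<lambda>v\<in>dary_tree_verts d n. v \<in> A))"
    by (rule finite_subset)
      (intro finite_UN_I finite_dary_tree_leaves fin_digraph.apaths_finite[OF fin_digraph_dary_tree])
qed

section \<open>Choice of constants and conclusion\<close>

lemma kwise_indep_percolations_mono:
  assumes "j \<le> k" shows "kwise_indep_percolations G k p \<subseteq> kwise_indep_percolations G j p"
  using assms unfolding kwise_indep_percolations_def by fastforce

theorem theorem21:
  fixes d :: nat and p :: real
  assumes "d \<ge> 2" and "0 < p" and "p < 1"
  shows "\<exists>C :: real. C > 0 \<and>
           (\<forall>\<^sub>F n :: nat in sequentially.
              \<exists>Q \<in> kwise_indep_percolations (dary_tree d n) (nat \<lfloor>C * ln (real n)\<rfloor>) p.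
                prob_space.expectation Q (\<lambda>\<omega>. real (card (open_root_leaf_paths d n \<omega>))) \<ge> 2)"
proof -
  \<comment> \<open>The loss per degree in \<open>kwise_law_on_tree\<close>.\<close>
  define L where "L = hyp_const p * (1 + 50 * (bern_char p True)\<^sup>2)"
  have L: "1 \<le> L"
    unfolding L_def using mult_mono[of 1 "hyp_const p" 1 "1 + 50 * (bern_char p True)\<^sup>2"]
      hyp_const_ge[OF assms(2,3)] by simp
  have "(\<lambda>n :: nat. real n powr ln L / (6 / 5) ^ n) \<longlonglongrightarrow> 0" by real_asymp
  \<comment> \<open>The 4 combines the target 2 with the 2 in the loss, d comes from the mean number
    of leaves, and the extra \<open>L\<close> pays for using degree \<open>Suc k\<close>.\<close>
  then have "\<forall>\<^sub>F n in sequentially. real n powr ln L / (6 / 5) ^ n < 1 / (4 * real d * L)"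
    using assms(1) L by (intro order_tendstoD) auto
  moreover have "\<forall>\<^sub>F n :: nat in sequentially. 1 \<le> n" by (rule eventually_ge_at_top)
  ultimately have "\<forall>\<^sub>F n :: nat in sequentially.
      \<exists>Q \<in> kwise_indep_percolations (dary_tree d n) (nat \<lfloor>1 * ln (real n)\<rfloor>) p.
        prob_space.expectation Q (\<lambda>\<omega>. real (card (open_root_leaf_paths d n \<omega>))) \<ge> 2"
  proof eventually_elim
    case (elim n)
    define k where "k = nat \<lfloor>ln (real n)\<rfloor>"
    let ?V = "dary_tree_verts d n"
    \<comment> \<open>With k \<le> ln n the loss is at most the fixed power n^(ln L), which (6/5)^n
      beats; hence C = 1 works.\<close>
    have "L ^ k = L powr real k" using L by (simp add: powr_realpow)
    also have "\<dots> \<le> L powr ln (real n)"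
      using L elim(2) by (intro powr_mono) (auto simp: k_def)
    also have "\<dots> = real n powr ln L" using L elim(2) by (simp add: powr_def mult.commute)
    finally have "L ^ k / (6 / 5) ^ n \<le> real n powr ln L / (6 / 5) ^ n"
      by (intro divide_right_mono) auto
    then have "L ^ k / (6 / 5) ^ n < 1 / (4 * real d * L)" using elim(1) by linarith
    then have large: "2 \<le> (6 / 5) ^ n / real d / (2 * L ^ Suc k)"
      using assms(1) L by (simp add: field_simps)
    have "verts (dary_tree d n) = ?V" by (simp add: dary_tree_def)
    \<comment> \<open>Degree \<open>Suc k\<close> replaces k because k may be 0, whereas
      \<open>kwise_percolation_of_weights\<close> needs degree at least 1; monotonicity returns to k
      at the end.\<close>
    obtain w where w: "\<And>A. A \<subseteq> ?V \<Longrightarrow> 0 \<le> w A" "sum w (Pow ?V) = 1"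
      "\<And>W. W \<subseteq> ?V \<Longrightarrow> W \<noteq> {} \<Longrightarrow> card W \<le> Suc k \<Longrightarrow> (\<Sum>A\<in>Pow ?V. w A * walsh p W A) = 0"
      "(6 / 5) ^ n / real d / (2 * L ^ Suc k) \<le> (\<Sum>A\<in>Pow ?V. w A * real (card (open_leaves d n A)))"
      using kwise_law_on_tree[OF assms(2,3,1), of n "Suc k"] elim(2) unfolding L_def by auto
    obtain Q where Q: "Q \<in> kwise_indep_percolations (dary_tree d n) (Suc k) p"
      "\<And>F :: (nat list \<Rightarrow> bool) \<Rightarrow> real. prob_space.expectation Q F = (\<Sum>A\<in>Pow ?V. w A * F (\<lambda>v\<in>?V. v \<in> A))"
      using kwise_percolation_of_weights[OF assms(2,3), of "dary_tree d n" w "Suc k"] w(1-3)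
      unfolding \<open>verts (dary_tree d n) = ?V\<close> using finite_dary_tree_verts by auto
    have "2 \<le> (\<Sum>A\<in>Pow ?V. w A * real (card (open_leaves d n A)))"
      using large w(4) by linarith
    also have "\<dots> \<le> prob_space.expectation Q (\<lambda>\<omega>. real (card (open_root_leaf_paths d n \<omega>)))"
      unfolding Q(2) using card_open_leaves_le w(1) by (intro sum_mono mult_left_mono) auto
    finally show ?case
      using Q(1) kwise_indep_percolations_mono[of k "Suc k"] by (auto simp: k_def)
  qed
  then show ?thesis by (intro exI[of _ 1]) simp
qed

end
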